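(* The saturated cluster modular group $\widehat{\Gamma}_{X_7}$ is generated by the elements $\psi_k,\phi_k$ for $k=1,3,5$ and the permutation group $\mathcal{S}_3$ of the numbers $\{1,3,5\}$, and a complete set of relations among these generators (that is, a presentation of $\widehat{\Gamma}_{X_7}$) is given by $$\sigma\psi_k\sigma^{-1}=\psi_{\sigma(k)},\qquad \sigma\phi_k\sigma^{-1}=\phi_{\sigma(k)}\qquad\text{for all }\sigma\in\mathcal{S}_3,\ k=1,3,5,$$ $$\phi_1\phi_3=\phi_3\phi_1,\qquad \phi_1=\psi_1^2\sigma_{35},\qquad 1=(\psi_3^{-1}\psi_1)^2,\qquad 1=\sigma_{153}\psi_5\psi_1\psi_3\psi_5\psi_1,$$ together with the usual relations of permutations (the multiplication table of $\mathcal{S}_3$).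
   Context: Matrices and mutations. Let $I$ be a finite set (no frozen vertices here) and $\varepsilon=(\varepsilon_{ij})_{i,j\in I}$ an integer skew-symmetric matrix (exchange matrix), identified with the quiver with vertex set $I$ and $\varepsilon_{ij}$ arrows $i\to j$ whenever $\varepsilon_{ij}>0$. For $k\in I$, the mutation $\mu_k(\varepsilon)=\varepsilon'$ is $\varepsilon'_{ij}=-\varepsilon_{ij}$ if $k\in\{i,j\}$, and $\varepsilon'_{ij}=\varepsilon_{ij}+\frac12(|\varepsilon_{ik}|\varepsilon_{kj}+\varepsilon_{ik}|\varepsilon_{kj}|)$ otherwise. A permutation $\sigma$ of $I$ acts by $\sigma(\varepsilon)_{ij}=\varepsilon_{\sigma^{-1}(i),\sigma^{-1}(j)}$. A mutation sequence is a finite composition of mutations and permutations, applied from right to left; it is a mutation loop at $\varepsilon$ if it sends $\varepsilon$ to $\varepsilon$. Saturated cluster modular group. $\widehat{\Gamma}_\varepsilon$ is the group (under composition) of mutation loops with initial exchange matrix $\varepsilon$, modulo the equivalence relation generated by: (1) $\mu_k\mu_k=1$; (2) $\sigma\mu_k\sigma^{-1}=\mu_{\sigma(k)}$ for permutations $\sigma$; (3) the standard relations, applicable at any stage of a sequence to the current matrix $\varepsilon'$: $\mu_i\mu_j=\mu_j\mu_i$ if $\varepsilon'_{ij}=0$, and $\mu_i\mu_j\mu_i\mu_j\mu_i=(i\ j)$ if $\varepsilon'_{ij}=\pm1$. Permutations compose as usual (right to left). Type $X_7$. $I=\{0,1,\dots,6\}$, and the quiver $X_7$ has, for each $k\in\{1,3,5\}$,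 one arrow $0\to k$, two arrows $k\to k+1$, one arrow $k+1\to 0$, and no other arrows. $\widehat{\Gamma}_{X_7}$ is the saturated cluster modular group based at this quiver. Elements. A permutation $\sigma$ of $\{1,3,5\}$ is regarded as the permutation of $I$ with $0\mapsto0$, $k\mapsto\sigma(k)$, $k+1\mapsto\sigma(k)+1$ for $k\in\{1,3,5\}$; these preserve the quiver $X_7$ and form $\mathcal{S}_3\subset\widehat{\Gamma}_{X_7}$. $\sigma_{ij}$ denotes the transposition of $i$ and $j$, and $\sigma_{153}$ the cyclic permutation $1\mapsto5\mapsto3\mapsto1$. The remaining generators are $\phi_1=(1\ 2)\mu_1$, $\phi_3=(3\ 4)\mu_3$, $\phi_5=(5\ 6)\mu_5$, and $\psi_1=(0\ 1\ 2)(3\ 4\ 5\ 6)\mu_2\mu_1\mu_0$, $\psi_3=(0\ 3\ 4)(5\ 6\ 1\ 2)\mu_4\mu_3\mu_0$, $\psi_5=(0\ 5\ 6)(1\ 2\ 3\ 4)\mu_6\mu_5\mu_0$, where $(a\ b\ c\ \cdots)$ denotes the cycle $a\mapsto b\mapsto c\mapsto\cdots$. *)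

theory Defs
  imports "HOL-Algebra.Generated_Groups" "HOL-Combinatorics.Cycles"
begin

section \<open>Groups of words modulo a congruence\<close>

text \<open>\<open>W\<close> is a set of words closed under concatenation and \<open>E\<close> a congruence on \<open>W\<close>;
  the product of two classes is the class of the concatenation of representatives.\<close>

definition word_quotient :: "'a list set \<Rightarrow> ('a list \<times> 'a list) set \<Rightarrow> 'a list set monoid" where
  "word_quotient W E =
     \<lparr>carrier = W // E,
      monoid.mult = (\<lambda>A B. \<Union>u\<in>A. \<Union>v\<in>B. E `` {u @ v}),
      one = E `` {[]}\<rparr>"

section \<open>Presentations by generators and relations\<close>

text \<open>In a signed word the letter \<open>(x, True)\<close> stands for \<open>x\<close> and \<open>(x, False)\<close> for its
  inverse. A relation \<open>R l r\<close> between signed words is the equation \<open>l = r\<close>.\<close>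

type_synonym 'x signed_word = "('x \<times> bool) list"

definition signed_words :: "'x set \<Rightarrow> 'x signed_word set" where
  "signed_words X = lists (X \<times> UNIV)"

inductive pres_step ::
  "'x set \<Rightarrow> ('x signed_word \<Rightarrow> 'x signed_word \<Rightarrow> bool) \<Rightarrow> 'x signed_word \<Rightarrow> 'x signed_word \<Rightarrow> bool"
  for X R where
  cancel: "\<lbrakk>x \<in> X; u \<in> signed_words X; v \<in> signed_words X\<rbrakk>
    \<Longrightarrow> pres_step X R (u @ [(x, b), (x, \<not> b)] @ v) (u @ v)"
| relation: "\<lbrakk>R l r; l \<in> signed_words X; r \<in> signed_words X; u \<in> signed_words X; v \<in> signed_words X\<rbrakk>
    \<Longrightarrow> pres_step X R (u @ l @ v) (u @ r @ v)"

definition pres_equiv ::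
  "'x set \<Rightarrow> ('x signed_word \<Rightarrow> 'x signed_word \<Rightarrow> bool) \<Rightarrow> ('x signed_word \<times> 'x signed_word) set" where
  "pres_equiv X R =
     {(u, v). u \<in> signed_words X \<and> v \<in> signed_words X \<and> equivclp (pres_step X R) u v}"

definition presented_group ::
  "'x set \<Rightarrow> ('x signed_word \<Rightarrow> 'x signed_word \<Rightarrow> bool) \<Rightarrow> 'x signed_word set monoid" where
  "presented_group X R = word_quotient (signed_words X) (pres_equiv X R)"

text \<open>\<open>is_presentation G f X R\<close>: the assignment \<open>f\<close> of elements of \<open>G\<close> to the letters in \<open>X\<close>
  extends to an isomorphism from the group presented by \<open>X\<close> and \<open>R\<close> onto \<open>G\<close>.\<close>

definition is_presentation ::
  "('g, 'm) monoid_scheme \<Rightarrow> ('x \<Rightarrow> 'g) \<Rightarrow> 'x set \<Rightarrow>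
   ('x signed_word \<Rightarrow> 'x signed_word \<Rightarrow> bool) \<Rightarrow> bool" where
  "is_presentation G f X R \<longleftrightarrow>
     (\<exists>h \<in> iso (presented_group X R) G. \<forall>x\<in>X. h (pres_equiv X R `` {[(x, True)]}) = f x)"

section \<open>Exchange matrices and mutations\<close>

text \<open>Matrices indexed by the finite set \<open>I\<close> are functions vanishing off \<open>I \<times> I\<close>, so that
  equality of functions is equality of matrices.\<close>

type_synonym 'i matrix = "'i \<Rightarrow> 'i \<Rightarrow> int"

definition exchange_matrix :: "'i set \<Rightarrow> 'i matrix \<Rightarrow> bool" where
  "exchange_matrix I \<epsilon> \<longleftrightarrow> finite I \<and> (\<forall>i j. \<epsilon> j i = - \<epsilon> i j)
     \<and> (\<forall>i j. i \<notin> I \<or> j \<notin> I \<longrightarrow> \<epsilon> i j = 0)"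

text \<open>The division by 2 is exact.\<close>

definition mutate :: "'i \<Rightarrow> 'i matrix \<Rightarrow> 'i matrix" where
  "mutate k \<epsilon> = (\<lambda>i j. if k = i \<or> k = j then - \<epsilon> i j
     else \<epsilon> i j + (\<bar>\<epsilon> i k\<bar> * \<epsilon> k j + \<epsilon> i k * \<bar>\<epsilon> k j\<bar>) div 2)"

definition permute_matrix :: "('i \<Rightarrow> 'i) \<Rightarrow> 'i matrix \<Rightarrow> 'i matrix" where
  "permute_matrix \<sigma> \<epsilon> = (\<lambda>i j. \<epsilon> (Hilbert_Choice.inv \<sigma> i) (Hilbert_Choice.inv \<sigma> j))"

section \<open>The saturated cluster modular group\<close>

datatype 'i move = Mut 'i | Perm "'i \<Rightarrow> 'i"

fun apply_move :: "'i move \<Rightarrow> 'i matrix \<Rightarrow> 'i matrix" where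
  "apply_move (Mut k) \<epsilon> = mutate k \<epsilon>"
| "apply_move (Perm \<sigma>) \<epsilon> = permute_matrix \<sigma> \<epsilon>"

definition mutation_sequences :: "'i set \<Rightarrow> 'i move list set" where
  "mutation_sequences I = lists (Mut ` I \<union> Perm ` {\<sigma>. \<sigma> permutes I})"

text \<open>Sequences are written like compositions: the last entry of the list is applied first.\<close>

definition apply_seq :: "'i move list \<Rightarrow> 'i matrix \<Rightarrow> 'i matrix" where
  "apply_seq w \<epsilon> = foldr apply_move w \<epsilon>"

definition mutation_loops :: "'i set \<Rightarrow> 'i matrix \<Rightarrow> 'i move list set" where
  "mutation_loops I \<epsilon> = {w \<in> mutation_sequences I. apply_seq w \<epsilon> = \<epsilon>}"

text \<open>The defining relations that may be applied when \<open>\<epsilon>\<close> is the current exchange matrix.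
  The first two say that permutations compose as usual.\<close>

inductive mut_relation :: "'i set \<Rightarrow> 'i matrix \<Rightarrow> 'i move list \<Rightarrow> 'i move list \<Rightarrow> bool"
  for I \<epsilon> where
  perm_id: "mut_relation I \<epsilon> [Perm id] []"
| perm_comp: "\<lbrakk>\<sigma> permutes I; \<tau> permutes I\<rbrakk>
    \<Longrightarrow> mut_relation I \<epsilon> [Perm \<sigma>, Perm \<tau>] [Perm (\<sigma> \<circ> \<tau>)]"
| involution: "k \<in> I \<Longrightarrow> mut_relation I \<epsilon> [Mut k, Mut k] []"
| conjugation: "\<lbrakk>\<sigma> permutes I; k \<in> I\<rbrakk>
    \<Longrightarrow> mut_relation I \<epsilon> [Perm \<sigma>, Mut k, Perm (Hilbert_Choice.inv \<sigma>)] [Mut (\<sigma> k)]"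
| square: "\<lbrakk>i \<in> I; j \<in> I; \<epsilon> i j = 0\<rbrakk>
    \<Longrightarrow> mut_relation I \<epsilon> [Mut i, Mut j] [Mut j, Mut i]"
| pentagon: "\<lbrakk>i \<in> I; j \<in> I; \<epsilon> i j = 1 \<or> \<epsilon> i j = -1\<rbrakk>
    \<Longrightarrow> mut_relation I \<epsilon> [Mut i, Mut j, Mut i, Mut j, Mut i] [Perm (transpose i j)]"

text \<open>In a sequence \<open>u @ l @ v\<close> starting at \<open>\<epsilon>\<close>, the matrix reached when \<open>l\<close> is about to be
  applied is \<open>apply_seq v \<epsilon>\<close>.\<close>

inductive mut_step :: "'i set \<Rightarrow> 'i matrix \<Rightarrow> 'i move list \<Rightarrow> 'i move list \<Rightarrow> bool"
  for I \<epsilon> where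
  "\<lbrakk>u \<in> mutation_sequences I; v \<in> mutation_sequences I; mut_relation I (apply_seq v \<epsilon>) l r\<rbrakk>
    \<Longrightarrow> mut_step I \<epsilon> (u @ l @ v) (u @ r @ v)"

definition mut_equiv :: "'i set \<Rightarrow> 'i matrix \<Rightarrow> ('i move list \<times> 'i move list) set" where
  "mut_equiv I \<epsilon> =
     {(u, v). u \<in> mutation_loops I \<epsilon> \<and> v \<in> mutation_loops I \<epsilon> \<and> equivclp (mut_step I \<epsilon>) u v}"

definition saturated_cluster_modular_group ::
  "'i set \<Rightarrow> 'i matrix \<Rightarrow> 'i move list set monoid" where
  "saturated_cluster_modular_group I \<epsilon> = word_quotient (mutation_loops I \<epsilon>) (mut_equiv I \<epsilon>)"

section \<open>The quiver of type X7 and the distinguished elements\<close>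

definition X7_vertices :: "nat set" where
  "X7_vertices = {0, 1, 2, 3, 4, 5, 6}"

definition X7_arrows :: "nat \<Rightarrow> nat \<Rightarrow> nat" where
  "X7_arrows i j =
     (if i = 0 \<and> j \<in> {1, 3, 5} then 1
      else if i \<in> {1, 3, 5} \<and> j = i + 1 then 2
      else if i \<in> {2, 4, 6} \<and> j = 0 then 1
      else 0)"

definition X7_matrix :: "nat matrix" where
  "X7_matrix i j = int (X7_arrows i j) - int (X7_arrows j i)"

lemma exchange_matrix_X7: "exchange_matrix X7_vertices X7_matrix"
  by (auto simp: exchange_matrix_def X7_vertices_def X7_matrix_def X7_arrows_def)

abbreviation X7_group :: "nat move list set monoid" where
  "X7_group \<equiv> saturated_cluster_modular_group X7_vertices X7_matrix"

text \<open>The permutation of the vertices induced by a permutation of 1, 3, 5.\<close>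

definition S3_extend :: "(nat \<Rightarrow> nat) \<Rightarrow> nat \<Rightarrow> nat" where
  "S3_extend \<sigma> i =
     (if i \<in> {1, 3, 5} then \<sigma> i else if i \<in> {2, 4, 6} then \<sigma> (i - 1) + 1 else i)"

definition phi_seq :: "nat \<Rightarrow> nat move list" where
  "phi_seq k = [Perm (transpose k (k + 1)), Mut k]"

definition psi_seq :: "nat \<Rightarrow> nat move list" where
  "psi_seq k =
     (if k = 1 then [Perm (cycle_of_list [0, 1, 2] \<circ> cycle_of_list [3, 4, 5, 6]), Mut 2, Mut 1, Mut 0]
      else if k = 3 then [Perm (cycle_of_list [0, 3, 4] \<circ> cycle_of_list [5, 6, 1, 2]), Mut 4, Mut 3, Mut 0]
      else [Perm (cycle_of_list [0, 5, 6] \<circ> cycle_of_list [1, 2, 3, 4]), Mut 6, Mut 5, Mut 0])"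

text \<open>Names of the generators; every element of the symmetric group on 1, 3, 5 is one.\<close>

datatype X7_gen = Psi nat | Phi nat | Sigma_perm "nat \<Rightarrow> nat"

definition X7_gens :: "X7_gen set" where
  "X7_gens = Psi ` {1, 3, 5} \<union> Phi ` {1, 3, 5} \<union> Sigma_perm ` {\<sigma>. \<sigma> permutes {1, 3, 5}}"

fun X7_gen_seq :: "X7_gen \<Rightarrow> nat move list" where
  "X7_gen_seq (Psi k) = psi_seq k"
| "X7_gen_seq (Phi k) = phi_seq k"
| "X7_gen_seq (Sigma_perm \<sigma>) = [Perm (S3_extend \<sigma>)]"

definition X7_gen_elem :: "X7_gen \<Rightarrow> nat move list set" where
  "X7_gen_elem x = mut_equiv X7_vertices X7_matrix `` {X7_gen_seq x}"

abbreviation psi :: "nat \<Rightarrow> X7_gen signed_word" where "psi k \<equiv> [(Psi k, True)]"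
abbreviation psi_inv :: "nat \<Rightarrow> X7_gen signed_word" where "psi_inv k \<equiv> [(Psi k, False)]"
abbreviation phi :: "nat \<Rightarrow> X7_gen signed_word" where "phi k \<equiv> [(Phi k, True)]"
abbreviation sig :: "(nat \<Rightarrow> nat) \<Rightarrow> X7_gen signed_word" where "sig \<sigma> \<equiv> [(Sigma_perm \<sigma>, True)]"
abbreviation sig_inv :: "(nat \<Rightarrow> nat) \<Rightarrow> X7_gen signed_word" where "sig_inv \<sigma> \<equiv> [(Sigma_perm \<sigma>, False)]"

inductive X7_relation :: "X7_gen signed_word \<Rightarrow> X7_gen signed_word \<Rightarrow> bool" where
  S3_table: "\<lbrakk>\<sigma> permutes {1, 3, 5}; \<tau> permutes {1, 3, 5}\<rbrakk>
    \<Longrightarrow> X7_relation (sig \<sigma> @ sig \<tau>) (sig (\<sigma> \<circ> \<tau>))"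
| sig_psi: "\<lbrakk>\<sigma> permutes {1, 3, 5}; k \<in> {1, 3, 5}\<rbrakk>
    \<Longrightarrow> X7_relation (sig \<sigma> @ psi k @ sig_inv \<sigma>) (psi (\<sigma> k))"
| sig_phi: "\<lbrakk>\<sigma> permutes {1, 3, 5}; k \<in> {1, 3, 5}\<rbrakk>
    \<Longrightarrow> X7_relation (sig \<sigma> @ phi k @ sig_inv \<sigma>) (phi (\<sigma> k))"
| phi_commute: "X7_relation (phi 1 @ phi 3) (phi 3 @ phi 1)"
| phi_psi: "X7_relation (phi 1) (psi 1 @ psi 1 @ sig (transpose 3 5))"
| psi_square: "X7_relation [] (psi_inv 3 @ psi 1 @ psi_inv 3 @ psi 1)"
| psi_five: "X7_relation []
    (sig (cycle_of_list [1, 5, 3]) @ psi 5 @ psi 1 @ psi 3 @ psi 5 @ psi 1)"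

end

theory Submission
  imports Defs
begin

text \<open>
Up to relabelling of the vertices, the mutation class of \<open>X\<^sub>7\<close> contains just two quivers: \<open>X\<close>, which
is \<open>X\<^sub>7\<close> itself, and \<open>Y = \<mu>\<^sub>0 X\<close>. The automorphisms of either quiver form the group \<open>\<S>\<^sub>3\<close> that permutes
the three wings \<open>{1,2}\<close>, \<open>{3,4}\<close>, \<open>{5,6}\<close>. Mutation at 0 exchanges \<open>X\<close> and \<open>Y\<close>.
Mutation at a vertex of wing \<open>k\<close> returns to the same quiver after a relabelling; read as a loop
based at \<open>X\<close>, it is \<open>\<phi>\<^sub>k\<close> or its inverse when performed at \<open>X\<close>, and \<open>\<psi>\<^sub>k\<close> or its inverse when performed
at \<open>Y\<close> (go to \<open>Y\<close> by \<open>\<mu>\<^sub>0\<close>, mutate, come back). So a mutation sequence, read modulo relabelling,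
spells a word in \<open>\<phi>\<^sub>k\<close>, \<open>\<psi>\<^sub>k\<close> and \<open>\<S>\<^sub>3\<close>, which is why these elements generate.

The relations come from the squares and pentagons. Modulo \<open>\<S>\<^sub>3\<close> and modulo the choice of a
corner there are four such polygons, and each gives one relation:

  \<^item> the squares at \<open>X\<close> give \<open>\<phi>\<^sub>1\<phi>\<^sub>3 = \<phi>\<^sub>3\<phi>\<^sub>1\<close>;
  \<^item> the pentagons with corners both at \<open>X\<close> and at \<open>Y\<close> give \<open>\<phi>\<^sub>1 = \<psi>\<^sub>1\<^sup>2\<sigma>\<^sub>3\<^sub>5\<close>;
  \<^item> the squares at \<open>Y\<close> give \<open>(\<psi>\<^sub>3\<inverse>\<psi>\<^sub>1)\<^sup>2 = 1\<close>;
  \<^item> the pentagons with all corners at \<open>Y\<close> give \<open>\<sigma>\<^sub>1\<^sub>5\<^sub>3\<psi>\<^sub>5\<psi>\<^sub>1\<psi>\<^sub>3\<psi>\<^sub>5\<psi>\<^sub>1 = 1\<close>.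

The proof makes the reading of words precise. A chart \<open>(x, \<theta>, g)\<close> records which model quiver the
current matrix is (\<open>x\<close>), how its labels are identified with those of the model (\<open>\<theta>\<close>) and the word
spelled so far (\<open>g\<close>). Mutation sequences act on charts, and two charts are regarded as the same
if they differ by an element of \<open>\<S>\<^sub>3\<close>, the word being compared in the presented group. Checking the
four polygons at their corners, taken modulo \<open>\<S>\<^sub>3\<close>, shows that this action respects all defining
relations of mutation sequences (\<open>run_relation\<close>). Spelling out a word in the generators and reading
it back gives the same element of the presented group (\<open>run_word_seq\<close>), so distinct elements stay
distinct in the cluster modular group (\<open>word_seq_inject\<close>). Conversely, every sequence is equivalent
to the word it spells, followed by the path to the model and a relabelling (\<open>pull_back_chart\<close>). A
loop can only end at \<open>X\<close> with a relabelling from \<open>\<S>\<^sub>3\<close> (\<open>stabilizer_X7\<close>), so every loop is a word in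
the generators (\<open>loop_is_word\<close>). That the listed relations hold in the cluster modular group is seen by pulling all
permutations to the left and using a single square or pentagon in each case
(\<open>relation_seq\<close>).
\<close>

section \<open>Quotients of word monoids\<close>

text \<open>The presented group and the cluster modular group are both quotients of a set of words by a
congruence, so the group axioms and the description of inverses are derived once for both.\<close>

locale word_congruence =
  fixes W :: "'a list set" and E :: "('a list \<times> 'a list) set"
  assumes Nil_in: "[] \<in> W"
    and append_in: "u \<in> W \<Longrightarrow> v \<in> W \<Longrightarrow> u @ v \<in> W"
    and equiv_E: "equiv W E"
    and cong: "(u, u') \<in> E \<Longrightarrow> (v, v') \<in> E \<Longrightarrow> (u @ v, u' @ v') \<in> E"
    and inverse_ex: "u \<in> W \<Longrightarrow> \<exists>u'\<in>W. (u' @ u, []) \<in> E"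
begin

lemma class_eq_iff: "u \<in> W \<Longrightarrow> v \<in> W \<Longrightarrow> E `` {u} = E `` {v} \<longleftrightarrow> (u, v) \<in> E"
  using equiv_E by (rule eq_equiv_class_iff)

lemma class_in: "u \<in> W \<Longrightarrow> E `` {u} \<in> carrier (word_quotient W E)"
  by (simp add: word_quotient_def quotientI)

lemma class_cases:
  assumes "A \<in> carrier (word_quotient W E)"
  obtains u where "u \<in> W" "A = E `` {u}"
  using assms by (auto simp: word_quotient_def elim: quotientE)

lemma mult_class:
  assumes "u \<in> W" "v \<in> W"
  shows "E `` {u} \<otimes>\<^bsub>word_quotient W E\<^esub> E `` {v} = E `` {u @ v}"
proof -
  have "E `` {a @ b} = E `` {u @ v}" if "a \<in> E `` {u}" "b \<in> E `` {v}" for a b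
    using that cong equiv_class_eq[OF equiv_E] by (metis Image_singleton_iff)
  moreover note equiv_class_self[OF equiv_E assms(1)] equiv_class_self[OF equiv_E assms(2)]
  ultimately have "(\<Union>a\<in>E `` {u}. \<Union>b\<in>E `` {v}. E `` {a @ b}) = E `` {u @ v}"
    by blast
  then show ?thesis by (simp add: word_quotient_def)
qed

lemma one_class: "\<one>\<^bsub>word_quotient W E\<^esub> = E `` {[]}"
  by (simp add: word_quotient_def)

lemma group_word_quotient: "group (word_quotient W E)" (is "group ?G")
proof (rule groupI)
  show "\<one>\<^bsub>?G\<^esub> \<in> carrier ?G"
    using class_in[OF Nil_in] by (simp add: one_class)
next
  fix A B assume "A \<in> carrier ?G" "B \<in> carrier ?G"
  then show "A \<otimes>\<^bsub>?G\<^esub> B \<in> carrier ?G"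
    by (elim class_cases) (simp add: mult_class class_in append_in)
next
  fix A B C assume "A \<in> carrier ?G" "B \<in> carrier ?G" "C \<in> carrier ?G"
  then show "A \<otimes>\<^bsub>?G\<^esub> B \<otimes>\<^bsub>?G\<^esub> C = A \<otimes>\<^bsub>?G\<^esub> (B \<otimes>\<^bsub>?G\<^esub> C)"
    by (elim class_cases) (simp add: mult_class append_in)
next
  fix A assume "A \<in> carrier ?G"
  then show "\<one>\<^bsub>?G\<^esub> \<otimes>\<^bsub>?G\<^esub> A = A"
    by (elim class_cases) (simp add: mult_class one_class Nil_in)
next
  fix A assume "A \<in> carrier ?G"
  then obtain u where u: "u \<in> W" "A = E `` {u}" by (elim class_cases)
  then obtain u' where "u' \<in> W" "(u' @ u, []) \<in> E" using inverse_ex by blast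
  then show "\<exists>B\<in>carrier ?G. B \<otimes>\<^bsub>?G\<^esub> A = \<one>\<^bsub>?G\<^esub>"
    using u by (intro bexI[of _ "E `` {u'}"])
      (simp_all add: mult_class one_class class_in class_eq_iff append_in Nil_in)
qed

lemma inv_class:
  assumes "u \<in> W" "u' \<in> W" "(u' @ u, []) \<in> E"
  shows "inv\<^bsub>word_quotient W E\<^esub> (E `` {u}) = E `` {u'}"
  using assms
  by (intro group.inv_equality[OF group_word_quotient])
    (simp_all add: mult_class one_class class_in class_eq_iff append_in Nil_in)

end

text \<open>A map of words that takes concatenation to concatenation descends to an isomorphism of the
quotients if it identifies two words exactly when the source congruence does and meets every
class of the target.\<close>

lemma word_quotient_iso:
  assumes "word_congruence W E" and "word_congruence W' E'"
    and in_W': "\<And>u. u \<in> W \<Longrightarrow> f u \<in> W'"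
    and append: "\<And>u v. f (u @ v) = f u @ f v"
    and iff: "\<And>u v. u \<in> W \<Longrightarrow> v \<in> W \<Longrightarrow> (f u, f v) \<in> E' \<longleftrightarrow> (u, v) \<in> E"
    and surj: "\<And>w. w \<in> W' \<Longrightarrow> \<exists>u\<in>W. (f u, w) \<in> E'"
  shows "\<exists>h \<in> iso (word_quotient W E) (word_quotient W' E'). \<forall>u\<in>W. h (E `` {u}) = E' `` {f u}"
proof -
  interpret A: word_congruence W E by fact
  interpret B: word_congruence W' E' by fact
  define h where "h A = E' `` {f (SOME u. u \<in> A)}" for A
  have h: "h (E `` {u}) = E' `` {f u}" if "u \<in> W" for u
  proof -
    have "u \<in> E `` {u}" using that by (rule equiv_class_self[OF A.equiv_E])
    then have "(u, SOME v. v \<in> E `` {u}) \<in> E" by (metis Image_singleton_iff someI_ex)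
    moreover from this have "(SOME v. v \<in> E `` {u}) \<in> W"
      using A.equiv_E by (auto simp: equiv_def refl_on_def)
    ultimately show ?thesis unfolding h_def
      using that iff in_W' B.class_eq_iff A.equiv_E by (metis equivE symE)
  qed
  have "h \<in> hom (word_quotient W E) (word_quotient W' E')"
    by (rule homI; elim A.class_cases)
      (simp_all add: h A.mult_class B.mult_class A.append_in append in_W' B.class_in)
  moreover have "inj_on h (carrier (word_quotient W E))"
    by (rule inj_onI; elim A.class_cases)
      (simp add: h A.class_eq_iff B.class_eq_iff in_W' iff)
  moreover have "h ` carrier (word_quotient W E) = carrier (word_quotient W' E')"
  proof
    show "h ` carrier (word_quotient W E) \<subseteq> carrier (word_quotient W' E')"
      by (auto elim!: A.class_cases simp: h in_W' B.class_in)
    show "carrier (word_quotient W' E') \<subseteq> h ` carrier (word_quotient W E)"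
    proof
      fix C assume "C \<in> carrier (word_quotient W' E')"
      then obtain w where w: "w \<in> W'" "C = E' `` {w}" by (elim B.class_cases)
      then obtain u where u: "u \<in> W" "(f u, w) \<in> E'" using surj by blast
      then have "C = h (E `` {u})" using w B.class_eq_iff[of "f u" w] by (simp add: h in_W')
      then show "C \<in> h ` carrier (word_quotient W E)" using A.class_in u(1) by blast
    qed
  qed
  ultimately show ?thesis using h by (auto simp: iso_def bij_betw_def)
qed

section \<open>Groups given by generators and relations\<close>

fun signed_inverse :: "'x signed_word \<Rightarrow> 'x signed_word" where
  "signed_inverse [] = []"
| "signed_inverse ((x, b) # u) = signed_inverse u @ [(x, \<not> b)]"

lemma signed_words_simps [simp]:
  "[] \<in> signed_words X"
  "(x, b) # u \<in> signed_words X \<longleftrightarrow> x \<in> X \<and> u \<in> signed_words X"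
  "u @ v \<in> signed_words X \<longleftrightarrow> u \<in> signed_words X \<and> v \<in> signed_words X"
  by (auto simp: signed_words_def)

lemma signed_inverse_in: "u \<in> signed_words X \<Longrightarrow> signed_inverse u \<in> signed_words X"
  by (induction u rule: signed_inverse.induct) auto

lemma pres_step_context:
  assumes "pres_step X R u v" "p \<in> signed_words X" "q \<in> signed_words X"
  shows "pres_step X R (p @ u @ q) (p @ v @ q)"
  using assms(1)
proof cases
  case (cancel x a b s)
  then show ?thesis
    using pres_step.cancel[of x X "p @ a" "b @ q" R s] assms(2,3) by simp
next
  case (relation l r a b)
  then show ?thesis
    using pres_step.relation[of R l r X "p @ a" "b @ q"] assms(2,3) by simp
qed

lemma equivclp_map:
  assumes "equivclp r u v" and "\<And>a b. r a b \<Longrightarrow> equivclp s (f a) (f b)"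
  shows "equivclp s (f u) (f v)"
  using assms(1)
proof (induction rule: equivclp_induct)
  case base
  then show ?case by simp
next
  case (step y z)
  then show ?case using assms(2) by (meson equivclp_sym equivclp_trans)
qed

lemma pres_equivclp_context:
  assumes "equivclp (pres_step X R) u v" "p \<in> signed_words X" "q \<in> signed_words X"
  shows "equivclp (pres_step X R) (p @ u @ q) (p @ v @ q)"
  using assms(1) by (rule equivclp_map) (use assms(2,3) pres_step_context in blast)

lemma signed_inverse_cancel:
  assumes "u \<in> signed_words X"
  shows "equivclp (pres_step X R) (signed_inverse u @ u) []"
  using assms
proof (induction u rule: signed_inverse.induct)
  case (2 x b u)
  then have "pres_step X R (signed_inverse u @ [(x, \<not> b), (x, b)] @ u) (signed_inverse u @ u)"
    using pres_step.cancel[of x X "signed_inverse u" u R "\<not> b"] by (simp add: signed_inverse_in)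
  moreover have "equivclp (pres_step X R) (signed_inverse u @ u) []" using 2 by simp
  ultimately have "equivclp (pres_step X R) (signed_inverse u @ [(x, \<not> b), (x, b)] @ u) []"
    by (blast intro: equivclp_trans)
  then show ?case by simp
qed simp

lemma word_congruence_pres: "word_congruence (signed_words X) (pres_equiv X R)"
proof
  show "equiv (signed_words X) (pres_equiv X R)"
  proof (rule equivI)
    show "pres_equiv X R \<subseteq> signed_words X \<times> signed_words X" by (auto simp: pres_equiv_def)
    show "refl_on (signed_words X) (pres_equiv X R)"
      by (auto simp: pres_equiv_def refl_on_def)
    show "sym (pres_equiv X R)"
      by (auto simp: pres_equiv_def sym_def intro: equivclp_sym)
    show "trans (pres_equiv X R)"
      by (auto simp: pres_equiv_def trans_def intro: equivclp_trans)
  qed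
next
  fix u u' v v' assume "(u, u') \<in> pres_equiv X R" "(v, v') \<in> pres_equiv X R"
  then show "(u @ v, u' @ v') \<in> pres_equiv X R"
    using pres_equivclp_context[of X R u u' "[]" v] pres_equivclp_context[of X R v v' u' "[]"]
    by (auto simp: pres_equiv_def intro: equivclp_trans)
next
  fix u assume "u \<in> signed_words X"
  then show "\<exists>u'\<in>signed_words X. (u' @ u, []) \<in> pres_equiv X R"
    using signed_inverse_cancel signed_inverse_in by (fastforce simp: pres_equiv_def)
qed simp_all

section \<open>Mutation sequences up to equivalence\<close>

lemma mutation_sequences_simps [simp]:
  "[] \<in> mutation_sequences I"
  "Mut k # w \<in> mutation_sequences I \<longleftrightarrow> k \<in> I \<and> w \<in> mutation_sequences I"
  "Perm \<sigma> # w \<in> mutation_sequences I \<longleftrightarrow> \<sigma> permutes I \<and> w \<in> mutation_sequences I"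
  "u @ w \<in> mutation_sequences I \<longleftrightarrow> u \<in> mutation_sequences I \<and> w \<in> mutation_sequences I"
  by (auto simp: mutation_sequences_def)

lemma map_Mut_in [simp]: "map Mut ks \<in> mutation_sequences I \<longleftrightarrow> set ks \<subseteq> I"
  by (induction ks) auto

lemma apply_seq_simps [simp]:
  "apply_seq [] \<epsilon> = \<epsilon>"
  "apply_seq (m # w) \<epsilon> = apply_move m (apply_seq w \<epsilon>)"
  "apply_seq (u @ w) \<epsilon> = apply_seq u (apply_seq w \<epsilon>)"
  by (simp_all add: apply_seq_def)

lemma mut_step_context:
  assumes "mut_step I (apply_seq q \<epsilon>) u v"
    and "p \<in> mutation_sequences I" "q \<in> mutation_sequences I"
  shows "mut_step I \<epsilon> (p @ u @ q) (p @ v @ q)"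
  using assms(1)
proof cases
  case (1 a b l r)
  then show ?thesis
    using mut_step.intros[of "p @ a" I "b @ q" \<epsilon> l r] assms(2,3) by simp
qed

lemma mut_equivclp_context:
  assumes "equivclp (mut_step I (apply_seq q \<epsilon>)) u v"
    and "p \<in> mutation_sequences I" "q \<in> mutation_sequences I"
  shows "equivclp (mut_step I \<epsilon>) (p @ u @ q) (p @ v @ q)"
  using assms(1) by (rule equivclp_map) (use assms(2,3) mut_step_context in blast)

lemma mut_equivclp_Cons:
  assumes "equivclp (mut_step I \<epsilon>) u v" and "[m] \<in> mutation_sequences I"
  shows "equivclp (mut_step I \<epsilon>) (m # u) (m # v)"
  using mut_equivclp_context[of I "[]" \<epsilon> u v "[m]"] assms by simp

lemma mut_equivclp_relation:
  assumes "mut_relation I (apply_seq q \<epsilon>) l r"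
    and "p \<in> mutation_sequences I" "q \<in> mutation_sequences I"
  shows "equivclp (mut_step I \<epsilon>) (p @ l @ q) (p @ r @ q)"
  using mut_step.intros[OF assms(2,3,1)] by blast

fun inverse_move :: "'i move \<Rightarrow> 'i move" where
  "inverse_move (Mut k) = Mut k"
| "inverse_move (Perm \<sigma>) = Perm (Hilbert_Choice.inv \<sigma>)"

definition inverse_seq :: "'i move list \<Rightarrow> 'i move list" where
  "inverse_seq w = rev (map inverse_move w)"

lemma inverse_seq_simps [simp]:
  "inverse_seq [] = []"
  "inverse_seq (m # w) = inverse_seq w @ [inverse_move m]"
  "inverse_seq (u @ w) = inverse_seq w @ inverse_seq u"
  by (simp_all add: inverse_seq_def)

lemma move_cases:
  assumes "m # w \<in> mutation_sequences I"
  obtains k where "m = Mut k" "k \<in> I" | \<sigma> where "m = Perm \<sigma>" "\<sigma> permutes I"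
  using assms by (cases m) auto

lemma inverse_seq_in: "w \<in> mutation_sequences I \<Longrightarrow> inverse_seq w \<in> mutation_sequences I"
proof (induction w)
  case (Cons m w)
  then show ?case by (cases m) (auto simp: permutes_inv)
qed simp

lemma inverse_seq_cancel:
  assumes "w \<in> mutation_sequences I"
  shows "equivclp (mut_step I \<epsilon>) (inverse_seq w @ w) []"
  using assms
proof (induction w)
  case (Cons m w)
  then have w: "w \<in> mutation_sequences I" by (cases m) auto
  have "equivclp (mut_step I \<epsilon>') [inverse_move m, m] []" for \<epsilon>'
    using Cons.prems
  proof (cases rule: move_cases)
    case (1 k)
    then show ?thesis
      using mut_equivclp_relation[of I "[]" \<epsilon>' "[Mut k, Mut k]" "[]" "[]"]
      by (simp add: mut_relation.involution)
  next
    case (2 \<sigma>)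
    then have "mut_relation I \<epsilon>' [Perm (Hilbert_Choice.inv \<sigma>), Perm \<sigma>]
        [Perm (Hilbert_Choice.inv \<sigma> \<circ> \<sigma>)]"
      by (intro mut_relation.perm_comp permutes_inv)
    with 2 have "equivclp (mut_step I \<epsilon>') [inverse_move m, m] [Perm id]"
      using mut_equivclp_relation[of I "[]" \<epsilon>' _ _ "[]"] by (fastforce simp: permutes_inv_o)
    moreover have "equivclp (mut_step I \<epsilon>') [Perm id] []"
      using mut_equivclp_relation[of I "[]" \<epsilon>' "[Perm id]" "[]" "[]"]
      by (simp add: mut_relation.perm_id)
    ultimately show ?thesis by (rule equivclp_trans)
  qed
  then have "equivclp (mut_step I \<epsilon>) (inverse_seq w @ [inverse_move m, m] @ w)
      (inverse_seq w @ [] @ w)"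
    by (intro mut_equivclp_context w inverse_seq_in)
  then show ?case using Cons.IH[OF w] by (simp add: equivclp_trans)
qed simp

text \<open>Negating the entries in row and column \<open>k\<close> negates the correction term; since that term is
even before it is halved, the integer division commutes with the sign.\<close>

lemma mutate_mutate: "mutate k (mutate k \<epsilon>) = \<epsilon>"
proof (intro ext)
  fix i j
  have neg: "- x div 2 = - (x div 2)" if "even x" for x :: int
    using that by (auto elim: evenE)
  show "mutate k (mutate k \<epsilon>) i j = \<epsilon> i j"
    using neg[of "\<bar>\<epsilon> i k\<bar> * \<epsilon> k j + \<epsilon> i k * \<bar>\<epsilon> k j\<bar>"] by (simp add: mutate_def)
qed

lemma permute_matrix_inv:
  assumes "\<sigma> permutes I"
  shows "permute_matrix (Hilbert_Choice.inv \<sigma>) (permute_matrix \<sigma> \<epsilon>) = \<epsilon>"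
  using assms by (simp add: permute_matrix_def permutes_inv_inv permutes_inverses)

lemma apply_inverse_seq:
  "w \<in> mutation_sequences I \<Longrightarrow> apply_seq (inverse_seq w) (apply_seq w \<epsilon>) = \<epsilon>"
proof (induction w)
  case (Cons m w)
  then show ?case by (cases m) (auto simp: mutate_mutate permute_matrix_inv)
qed simp

lemma inverse_seq_loop: "w \<in> mutation_loops I \<epsilon> \<Longrightarrow> inverse_seq w \<in> mutation_loops I \<epsilon>"
  using apply_inverse_seq[of w I \<epsilon>] by (simp add: mutation_loops_def inverse_seq_in)

lemma word_congruence_loops: "word_congruence (mutation_loops I \<epsilon>) (mut_equiv I \<epsilon>)"
proof
  show "equiv (mutation_loops I \<epsilon>) (mut_equiv I \<epsilon>)"
  proof (rule equivI)
    show "mut_equiv I \<epsilon> \<subseteq> mutation_loops I \<epsilon> \<times> mutation_loops I \<epsilon>" by (auto simp: mut_equiv_def)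
    show "refl_on (mutation_loops I \<epsilon>) (mut_equiv I \<epsilon>)"
      by (auto simp: mut_equiv_def refl_on_def)
    show "sym (mut_equiv I \<epsilon>)"
      by (auto simp: mut_equiv_def sym_def intro: equivclp_sym)
    show "trans (mut_equiv I \<epsilon>)"
      by (auto simp: mut_equiv_def trans_def intro: equivclp_trans)
  qed
next
  fix u u' v v' assume *: "(u, u') \<in> mut_equiv I \<epsilon>" "(v, v') \<in> mut_equiv I \<epsilon>"
  then have "equivclp (mut_step I \<epsilon>) (u @ v) (u' @ v)" "equivclp (mut_step I \<epsilon>) (u' @ v) (u' @ v')"
    using mut_equivclp_context[of I v \<epsilon> u u' "[]"] mut_equivclp_context[of I "[]" \<epsilon> v v' u']
    by (auto simp: mut_equiv_def mutation_loops_def)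
  with * show "(u @ v, u' @ v') \<in> mut_equiv I \<epsilon>"
    by (auto simp: mut_equiv_def mutation_loops_def intro: equivclp_trans)
next
  fix u assume "u \<in> mutation_loops I \<epsilon>"
  then show "\<exists>u'\<in>mutation_loops I \<epsilon>. (u' @ u, []) \<in> mut_equiv I \<epsilon>"
    using inverse_seq_loop[of u I \<epsilon>] inverse_seq_cancel[of u I \<epsilon>]
    by (intro bexI[of _ "inverse_seq u"]) (auto simp: mut_equiv_def mutation_loops_def)
qed (auto simp: mutation_loops_def)



section \<open>A normal form for mutation sequences\<close>

text \<open>By the conjugation relation a permutation can be moved to the left past all mutations, at the
price of relabelling them. The resulting list of mutation labels is then shortened by
cancelling equal neighbours. Two sequences with the same normal form are equivalent at every
matrix, because no square or pentagon is used.\<close>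

fun total_perm :: "'i move list \<Rightarrow> 'i \<Rightarrow> 'i" where
  "total_perm [] = id"
| "total_perm (Mut k # w) = total_perm w"
| "total_perm (Perm \<sigma> # w) = \<sigma> \<circ> total_perm w"

fun push_label :: "'i \<Rightarrow> 'i list \<Rightarrow> 'i list" where
  "push_label k [] = [k]"
| "push_label k (k' # ks) = (if k = k' then ks else k # k' # ks)"

text \<open>A mutation at \<open>k\<close> with total permutation \<open>\<sigma>\<close> to its right becomes a mutation at \<open>\<sigma>\<inverse> k\<close> when \<open>\<sigma>\<close>
moves to its left.\<close>

fun labels :: "'i move list \<Rightarrow> 'i list" where
  "labels [] = []"
| "labels (Mut k # w) = push_label (Hilbert_Choice.inv (total_perm w) k) (labels w)"
| "labels (Perm \<sigma> # w) = labels w"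

lemma total_perm_permutes: "w \<in> mutation_sequences I \<Longrightarrow> total_perm w permutes I"
  by (induction w rule: total_perm.induct) (auto simp: permutes_id permutes_compose)

lemma labels_in: "w \<in> mutation_sequences I \<Longrightarrow> set (labels w) \<subseteq> I"
proof (induction w rule: labels.induct)
  case (2 k w)
  then have "Hilbert_Choice.inv (total_perm w) k \<in> I"
    using permutes_in_image[OF permutes_inv[OF total_perm_permutes]] by fastforce
  with 2 show ?case by (cases "labels w") auto
qed auto

lemma Perm_id_cancel:
  assumes "p \<in> mutation_sequences I" "q \<in> mutation_sequences I"
  shows "equivclp (mut_step I \<epsilon>) (p @ Perm id # q) (p @ q)"
  using mut_equivclp_relation[of I q \<epsilon> "[Perm id]" "[]" p] assms
  by (simp add: mut_relation.perm_id)

lemma Perm_Perm: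
  assumes "p \<in> mutation_sequences I" "q \<in> mutation_sequences I" "\<sigma> permutes I" "\<tau> permutes I"
  shows "equivclp (mut_step I \<epsilon>) (p @ Perm \<sigma> # Perm \<tau> # q) (p @ Perm (\<sigma> \<circ> \<tau>) # q)"
  using mut_equivclp_relation[of I q \<epsilon> "[Perm \<sigma>, Perm \<tau>]" "[Perm (\<sigma> \<circ> \<tau>)]" p] assms
  by (simp add: mut_relation.perm_comp)

lemma Mut_Mut:
  assumes "p \<in> mutation_sequences I" "q \<in> mutation_sequences I" "k \<in> I"
  shows "equivclp (mut_step I \<epsilon>) (p @ Mut k # Mut k # q) (p @ q)"
  using mut_equivclp_relation[of I q \<epsilon> "[Mut k, Mut k]" "[]" p] assms
  by (simp add: mut_relation.involution)

lemma Mut_Perm: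
  assumes "p \<in> mutation_sequences I" "q \<in> mutation_sequences I" "\<sigma> permutes I" "k \<in> I"
  shows "equivclp (mut_step I \<epsilon>) (p @ Perm \<sigma> # Mut k # q) (p @ Mut (\<sigma> k) # Perm \<sigma> # q)"
proof -
  let ?i = "Hilbert_Choice.inv \<sigma>"
  have i: "?i permutes I" using assms by (simp add: permutes_inv)
  have "equivclp (mut_step I \<epsilon>) (p @ Perm \<sigma> # Mut k # Perm (?i \<circ> \<sigma>) # q)
      (p @ Perm \<sigma> # Mut k # q)"
    using Perm_id_cancel[of "p @ [Perm \<sigma>, Mut k]" I q] assms by (simp add: permutes_inv_o)
  moreover have "equivclp (mut_step I \<epsilon>) (p @ Perm \<sigma> # Mut k # Perm ?i # Perm \<sigma> # q)
      (p @ Perm \<sigma> # Mut k # Perm (?i \<circ> \<sigma>) # q)"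
    using Perm_Perm[of "p @ [Perm \<sigma>, Mut k]" I q ?i \<sigma>] assms i by simp
  moreover have "equivclp (mut_step I \<epsilon>) (p @ [Perm \<sigma>, Mut k, Perm ?i] @ Perm \<sigma> # q)
      (p @ [Mut (\<sigma> k)] @ Perm \<sigma> # q)"
    using assms by (intro mut_equivclp_relation mut_relation.conjugation) auto
  ultimately show ?thesis
    by (simp, meson equivclp_sym equivclp_trans)
qed

lemma push_label:
  assumes "p \<in> mutation_sequences I" "k \<in> I" "set ks \<subseteq> I"
  shows "equivclp (mut_step I \<epsilon>) (p @ Mut k # map Mut ks) (p @ map Mut (push_label k ks))"
  using assms Mut_Mut[of p I _ k \<epsilon>] by (cases ks) auto

lemma normal_form:
  "w \<in> mutation_sequences I \<Longrightarrow>
    equivclp (mut_step I \<epsilon>) w (Perm (total_perm w) # map Mut (labels w))"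
proof (induction w rule: labels.induct)
  case 1
  then show ?case using equivclp_sym[OF Perm_id_cancel[of "[]" I "[]" \<epsilon>]] by (simp add: id_def)
next
  case (2 k w)
  let ?\<sigma> = "total_perm w" and ?j = "Hilbert_Choice.inv (total_perm w) k"
  have \<sigma>: "?\<sigma> permutes I" and ls: "set (labels w) \<subseteq> I" and k: "k \<in> I"
    using 2 total_perm_permutes[of w I] labels_in[of w I] by auto
  then have j: "?\<sigma> ?j = k" "?j \<in> I"
    by (auto simp: permutes_inverses permutes_in_image[OF permutes_inv])
  have "equivclp (mut_step I \<epsilon>) (Mut k # w) (Mut k # Perm ?\<sigma> # map Mut (labels w))"
    using 2 by (intro mut_equivclp_Cons) auto
  also have "equivclp (mut_step I \<epsilon>) \<dots> (Perm ?\<sigma> # Mut ?j # map Mut (labels w))"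
    using Mut_Perm[of "[]" I "map Mut (labels w)" ?\<sigma> ?j \<epsilon>] j \<sigma> ls by (simp add: equivclp_sym)
  also have "equivclp (mut_step I \<epsilon>) \<dots> (Perm ?\<sigma> # map Mut (push_label ?j (labels w)))"
    using push_label[of "[Perm ?\<sigma>]" I ?j "labels w" \<epsilon>] \<sigma> ls j by simp
  finally show ?case by simp
next
  case (3 \<sigma> w)
  then have *: "total_perm w permutes I" "set (labels w) \<subseteq> I" "\<sigma> permutes I"
    using total_perm_permutes[of w I] labels_in[of w I] by auto
  have "equivclp (mut_step I \<epsilon>) (Perm \<sigma> # w) (Perm \<sigma> # Perm (total_perm w) # map Mut (labels w))"
    using 3 by (intro mut_equivclp_Cons) auto
  also have "equivclp (mut_step I \<epsilon>) \<dots> (Perm (\<sigma> \<circ> total_perm w) # map Mut (labels w))"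
    using Perm_Perm[of "[]" I "map Mut (labels w)" \<sigma> "total_perm w" \<epsilon>] * by simp
  finally show ?case by (simp add: comp_def)
qed

lemma normal_form_eqI:
  assumes "u \<in> mutation_sequences I" "v \<in> mutation_sequences I"
    and "\<And>i. i \<in> I \<Longrightarrow> total_perm u i = total_perm v i" and "labels u = labels v"
  shows "equivclp (mut_step I \<epsilon>) u v"
proof -
  have "total_perm u = total_perm v"
    using assms total_perm_permutes by (metis ext permutes_not_in)
  then show ?thesis
    using normal_form[OF assms(1), of \<epsilon>] normal_form[OF assms(2), of \<epsilon>] assms(4)
    by (metis equivclp_sym equivclp_trans)
qed



section \<open>Charts for the mutation class of X7\<close>

(* The vertex 1 has to stay a numeral for the tables of values below to match. *)
declare One_nat_def [simp del]

text \<open>The permutation part of \<open>\<psi>\<^sub>k\<close>. It also is the relabelling that brings \<open>\<mu>\<^sub>k Y\<close> back to \<open>Y\<close>: it puts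
the new centre \<open>k + 1\<close> of \<open>\<mu>\<^sub>k Y\<close> at the vertex 0.\<close>

definition psi_perm :: "nat \<Rightarrow> nat \<Rightarrow> nat" where
  "psi_perm k =
     (if k = 1 then cycle_of_list [0, 1, 2] \<circ> cycle_of_list [3, 4, 5, 6]
      else if k = 3 then cycle_of_list [0, 3, 4] \<circ> cycle_of_list [5, 6, 1, 2]
      else cycle_of_list [0, 5, 6] \<circ> cycle_of_list [1, 2, 3, 4])"

lemma psi_seq_eq:
  "k \<in> {1, 3, 5} \<Longrightarrow> psi_seq k = [Perm (psi_perm k), Mut (k + 1), Mut k, Mut 0]"
  by (auto simp: psi_seq_def psi_perm_def)

lemma psi_perm_permutes: "psi_perm k permutes X7_vertices"
proof -
  have "cycle_of_list cs permutes X7_vertices" if "set cs \<subseteq> X7_vertices" for cs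
    using cycle_permutes that by (rule permutes_subset)
  then show ?thesis
    unfolding psi_perm_def by (auto intro!: permutes_compose simp: X7_vertices_def simp del: cycle_of_list.simps)
qed

lemma psi_perm_simps [simp]:
  "psi_perm 1 0 = 1" "psi_perm 1 1 = 2" "psi_perm 1 2 = 0" "psi_perm 1 3 = 4" "psi_perm 1 4 = 5" "psi_perm 1 5 = 6" "psi_perm 1 6 = 3"
  "psi_perm 3 0 = 3" "psi_perm 3 1 = 2" "psi_perm 3 2 = 5" "psi_perm 3 3 = 4" "psi_perm 3 4 = 0" "psi_perm 3 5 = 6" "psi_perm 3 6 = 1"
  "psi_perm 5 0 = 5" "psi_perm 5 1 = 2" "psi_perm 5 2 = 3" "psi_perm 5 3 = 4" "psi_perm 5 4 = 1" "psi_perm 5 5 = 6" "psi_perm 5 6 = 0"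
  by (simp_all add: psi_perm_def transpose_def)

lemma inv_psi_perm_simps [simp]:
  "Hilbert_Choice.inv (psi_perm 1) 0 = 2" "Hilbert_Choice.inv (psi_perm 1) 1 = 0" "Hilbert_Choice.inv (psi_perm 1) 2 = 1" "Hilbert_Choice.inv (psi_perm 1) 3 = 6" "Hilbert_Choice.inv (psi_perm 1) 4 = 3" "Hilbert_Choice.inv (psi_perm 1) 5 = 4" "Hilbert_Choice.inv (psi_perm 1) 6 = 5"
  "Hilbert_Choice.inv (psi_perm 3) 0 = 4" "Hilbert_Choice.inv (psi_perm 3) 1 = 6" "Hilbert_Choice.inv (psi_perm 3) 2 = 1" "Hilbert_Choice.inv (psi_perm 3) 3 = 0" "Hilbert_Choice.inv (psi_perm 3) 4 = 3" "Hilbert_Choice.inv (psi_perm 3) 5 = 2" "Hilbert_Choice.inv (psi_perm 3) 6 = 5"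
  "Hilbert_Choice.inv (psi_perm 5) 0 = 6" "Hilbert_Choice.inv (psi_perm 5) 1 = 4" "Hilbert_Choice.inv (psi_perm 5) 2 = 1" "Hilbert_Choice.inv (psi_perm 5) 3 = 2" "Hilbert_Choice.inv (psi_perm 5) 4 = 3" "Hilbert_Choice.inv (psi_perm 5) 5 = 0" "Hilbert_Choice.inv (psi_perm 5) 6 = 5"
  by (simp_all add: permutes_inv_eq[OF psi_perm_permutes])

lemma all_vertices:
  "(\<forall>i\<in>X7_vertices. P i) \<longleftrightarrow> P 0 \<and> P 1 \<and> P 2 \<and> P 3 \<and> P 4 \<and> P 5 \<and> P 6"
  by (simp add: X7_vertices_def)

definition wing :: "nat \<Rightarrow> nat" where
  "wing j = (if j \<in> {1, 2} then 1 else if j \<in> {3, 4} then 3 else 5)"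

text \<open>The next four functions describe the two model quivers and one mutation of them; the boolean
\<open>x\<close> distinguishes \<open>X\<close> (true) from \<open>Y\<close> (false). Mutating the model at \<open>j\<close> leads to the model
\<open>target x j\<close>, with labels identified by \<open>relabel x j\<close>, and multiplies the word by \<open>coeff x j\<close>.
Odd and even vertices of a wing give mutually inverse steps, so the sign of the letter is
the parity of \<open>j\<close>. The step along the edge between \<open>X\<close> and \<open>Y\<close> costs nothing.\<close>

definition relabel :: "bool \<Rightarrow> nat \<Rightarrow> nat \<Rightarrow> nat" where
  "relabel x j =
     (if j = 0 then id
      else if x then transpose (wing j) (wing j + 1)
      else if odd j then psi_perm (wing j)
      else Hilbert_Choice.inv (psi_perm (wing j)))"

definition coeff :: "bool \<Rightarrow> nat \<Rightarrow> X7_gen signed_word" where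
  "coeff x j = (if j = 0 then [] else [((if x then Phi else Psi) (wing j), odd j)])"

definition target :: "bool \<Rightarrow> nat \<Rightarrow> bool" where
  "target x j = (if j = 0 then \<not> x else x)"

definition model :: "bool \<Rightarrow> nat matrix" where
  "model x = (if x then X7_matrix else mutate 0 X7_matrix)"

lemma relabel_permutes: "relabel x j permutes X7_vertices"
proof -
  have "wing j \<in> X7_vertices" "wing j + 1 \<in> X7_vertices"
    by (auto simp: wing_def X7_vertices_def)
  then show ?thesis
    by (simp add: relabel_def permutes_id permutes_swap_id permutes_inv psi_perm_permutes)
qed

lemma coeff_in: "coeff x j \<in> signed_words X7_gens"
  by (auto simp: coeff_def wing_def X7_gens_def)

lemma X7_matrix_outside: "i \<notin> X7_vertices \<or> j \<notin> X7_vertices \<Longrightarrow> X7_matrix i j = 0"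
  using exchange_matrix_X7 unfolding exchange_matrix_def by blast

lemma mutate_outside:
  assumes "\<And>i j. i \<notin> I \<or> j \<notin> I \<Longrightarrow> \<epsilon> i j = 0" "i \<notin> I \<or> j \<notin> I"
  shows "mutate k \<epsilon> i j = 0"
  using assms by (auto simp: mutate_def)

lemma model_outside: "i \<notin> X7_vertices \<or> j \<notin> X7_vertices \<Longrightarrow> model x i j = 0"
  unfolding model_def by (auto intro: X7_matrix_outside mutate_outside)


lemma mutate_model_vertices:
  assumes "j \<in> X7_vertices"
  shows "\<forall>i\<in>X7_vertices. \<forall>l\<in>X7_vertices.
     mutate j (model x) i l = model (target x j) (relabel x j i) (relabel x j l)"
proof -
  have j: "j = 0 \<or> j = 1 \<or> j = 2 \<or> j = 3 \<or> j = 4 \<or> j = 5 \<or> j = 6"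
    using assms by (simp add: X7_vertices_def)
  then show ?thesis
    unfolding all_vertices
    by (elim disjE; cases x; simp add: model_def target_def relabel_def wing_def mutate_def
        X7_matrix_def X7_arrows_def transpose_def)
qed

text \<open>The mutation class closes up on the two models: this is what makes charts possible.\<close>

lemma mutate_model:
  assumes "j \<in> X7_vertices"
  shows "mutate j (model x) i l = model (target x j) (relabel x j i) (relabel x j l)"
proof (cases "i \<in> X7_vertices \<and> l \<in> X7_vertices")
  case True
  then show ?thesis using mutate_model_vertices assms by blast
next
  case False
  then show ?thesis
    using relabel_permutes[of x j]
    by (metis model_outside mutate_outside permutes_not_in)
qed

section \<open>The symmetric group acting on the wings\<close>

abbreviation "S3 \<equiv> {\<sigma> :: nat \<Rightarrow> nat. \<sigma> permutes {1, 3, 5}}"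

lemma S3_cases:
  assumes "\<sigma> \<in> S3"
  shows "\<sigma> 1 = 1 \<and> \<sigma> 3 = 3 \<and> \<sigma> 5 = 5 \<or> \<sigma> 1 = 1 \<and> \<sigma> 3 = 5 \<and> \<sigma> 5 = 3
    \<or> \<sigma> 1 = 3 \<and> \<sigma> 3 = 1 \<and> \<sigma> 5 = 5 \<or> \<sigma> 1 = 3 \<and> \<sigma> 3 = 5 \<and> \<sigma> 5 = 1
    \<or> \<sigma> 1 = 5 \<and> \<sigma> 3 = 1 \<and> \<sigma> 5 = 3 \<or> \<sigma> 1 = 5 \<and> \<sigma> 3 = 3 \<and> \<sigma> 5 = 1"
proof -
  have "\<sigma> 1 \<in> {1, 3, 5}" "\<sigma> 3 \<in> {1, 3, 5}" "\<sigma> 5 \<in> {1, 3, 5}"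
    using assms by (simp_all only: mem_Collect_eq permutes_in_image) auto
  moreover have "\<sigma> 1 \<noteq> \<sigma> 3" "\<sigma> 1 \<noteq> \<sigma> 5" "\<sigma> 3 \<noteq> \<sigma> 5"
    using permutes_inj[of \<sigma> "{1, 3, 5}"] assms by (auto simp: inj_eq)
  ultimately show ?thesis by (elim insertE emptyE) simp_all
qed

lemma S3_extend_vertices [simp]:
  "S3_extend \<sigma> 0 = 0" "S3_extend \<sigma> 1 = \<sigma> 1" "S3_extend \<sigma> 2 = \<sigma> 1 + 1" "S3_extend \<sigma> 3 = \<sigma> 3"
  "S3_extend \<sigma> 4 = \<sigma> 3 + 1" "S3_extend \<sigma> 5 = \<sigma> 5" "S3_extend \<sigma> 6 = \<sigma> 5 + 1"
  by (simp_all add: S3_extend_def One_nat_def)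

lemma S3_extend_in: "\<sigma> \<in> S3 \<Longrightarrow> i \<in> X7_vertices \<Longrightarrow> S3_extend \<sigma> i \<in> X7_vertices"
  using S3_cases[of \<sigma>] by (auto simp: X7_vertices_def)

lemma S3_extend_outside: "i \<notin> X7_vertices \<Longrightarrow> S3_extend \<sigma> i = i"
  by (simp add: S3_extend_def X7_vertices_def)

lemma S3_extend_id [simp]: "S3_extend id = id"
  by (auto simp: S3_extend_def fun_eq_iff)

lemma S3_extend_comp:
  assumes "\<tau> \<in> S3" shows "S3_extend (\<sigma> \<circ> \<tau>) = S3_extend \<sigma> \<circ> S3_extend \<tau>"
proof
  fix i
  show "S3_extend (\<sigma> \<circ> \<tau>) i = (S3_extend \<sigma> \<circ> S3_extend \<tau>) i"
  proof (cases "i \<in> X7_vertices")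
    case True
    then show ?thesis using S3_cases[OF assms] by (auto simp: X7_vertices_def)
  qed (simp add: S3_extend_outside)
qed

lemma inv_in_S3: "\<sigma> \<in> S3 \<Longrightarrow> Hilbert_Choice.inv \<sigma> \<in> S3"
  by (simp add: permutes_inv)

lemma S3_extend_permutes: "\<sigma> \<in> S3 \<Longrightarrow> S3_extend \<sigma> permutes X7_vertices"
proof -
  assume \<sigma>: "\<sigma> \<in> S3"
  have "S3_extend \<sigma> \<circ> S3_extend (Hilbert_Choice.inv \<sigma>) = id"
    "S3_extend (Hilbert_Choice.inv \<sigma>) \<circ> S3_extend \<sigma> = id"
    using \<sigma> inv_in_S3[OF \<sigma>] by (simp_all flip: S3_extend_comp add: permutes_inv_o)
  then have "bij (S3_extend \<sigma>)" by (rule o_bij[rotated])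
  then show ?thesis
    using S3_extend_outside by (auto simp: permutes_def bij_iff)
qed

lemma inv_S3_extend:
  "\<sigma> \<in> S3 \<Longrightarrow> Hilbert_Choice.inv (S3_extend \<sigma>) = S3_extend (Hilbert_Choice.inv \<sigma>)"
  by (rule inv_unique_comp; subst S3_extend_comp[symmetric])
    (simp_all add: inv_in_S3 permutes_inv_o permutes_inv)

lemma S3_extend_inject:
  assumes "S3_extend \<sigma> = S3_extend \<tau>" "\<sigma> \<in> S3" "\<tau> \<in> S3" shows "\<sigma> = \<tau>"
proof
  fix i
  show "\<sigma> i = \<tau> i"
  proof (cases "i \<in> {1, 3, 5}")
    case True
    then show ?thesis using fun_cong[OF assms(1), of i] by (simp add: S3_extend_def)
  next
    case False
    then show ?thesis using assms(2,3) by (metis mem_Collect_eq permutes_not_in)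
  qed
qed



text \<open>Permuting the wings is a symmetry of both models and of all mutations between them. This is
what makes charts that differ by an element of \<open>\<S>\<^sub>3\<close> interchangeable.\<close>

lemma relabel_S3:
  assumes "\<sigma> \<in> S3" "j \<in> X7_vertices"
  shows "relabel x (S3_extend \<sigma> j) \<circ> S3_extend \<sigma> = S3_extend \<sigma> \<circ> relabel x j"
proof
  fix i
  have "\<forall>j\<in>X7_vertices. \<forall>i\<in>X7_vertices.
      relabel x (S3_extend \<sigma> j) (S3_extend \<sigma> i) = S3_extend \<sigma> (relabel x j i)"
    using S3_cases[OF assms(1)] unfolding all_vertices
    by (elim disjE conjE; cases x; simp add: relabel_def wing_def transpose_def)
  moreover have "relabel x (S3_extend \<sigma> j) i = i" "relabel x j i = i" if "i \<notin> X7_vertices"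
    using that relabel_permutes S3_extend_in assms by (metis permutes_not_in)+
  ultimately show "(relabel x (S3_extend \<sigma> j) \<circ> S3_extend \<sigma>) i = (S3_extend \<sigma> \<circ> relabel x j) i"
    using assms(2) by (cases "i \<in> X7_vertices") (auto simp: S3_extend_outside)
qed

lemma model_S3:
  assumes "\<sigma> \<in> S3"
  shows "model x (S3_extend \<sigma> i) (S3_extend \<sigma> j) = model x i j"
proof -
  have "\<forall>i\<in>X7_vertices. \<forall>j\<in>X7_vertices. model x (S3_extend \<sigma> i) (S3_extend \<sigma> j) = model x i j"
    using S3_cases[OF assms(1)] unfolding all_vertices
    by (elim disjE conjE; cases x; simp add: model_def mutate_def X7_matrix_def X7_arrows_def)
  then show ?thesis
    by (metis S3_extend_outside S3_extend_in assms model_outside)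
qed

lemma target_S3: "\<sigma> \<in> S3 \<Longrightarrow> j \<in> X7_vertices \<Longrightarrow> target x (S3_extend \<sigma> j) = target x j"
  using S3_cases[of \<sigma>] by (auto simp: X7_vertices_def target_def)

text \<open>The only double arrows of \<open>X\<^sub>7\<close> are those from \<open>k\<close> to \<open>k + 1\<close> for \<open>k = 1, 3, 5\<close>. An automorphism
permutes them, and then has no choice left for the vertex 0.\<close>

lemma stabilizer_X7:
  assumes "\<theta> permutes X7_vertices" and eq: "\<And>i j. X7_matrix (\<theta> i) (\<theta> j) = X7_matrix i j"
  shows "\<exists>\<sigma>\<in>S3. \<theta> = S3_extend \<sigma>"
proof -
  have double: "X7_matrix i j = 2 \<longleftrightarrow> i \<in> {1, 3, 5} \<and> j = i + 1" for i j
    by (auto simp: X7_matrix_def X7_arrows_def)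
  have wing: "\<theta> k \<in> {1, 3, 5} \<and> \<theta> (k + 1) = \<theta> k + 1" if "k \<in> {1, 3, 5}" for k
  proof -
    have "X7_matrix k (k + 1) = 2" using that by (simp only: double)
    then have "X7_matrix (\<theta> k) (\<theta> (k + 1)) = 2" by (simp only: eq)
    then show ?thesis by (simp only: double)
  qed
  have inj: "inj \<theta>" using assms(1) by (rule permutes_inj)
  define A :: "nat set" where "A = {1, 3, 5}"
  define \<sigma> where "\<sigma> k = (if k \<in> A then \<theta> k else k)" for k
  have "\<sigma> permutes A"
  proof (rule bij_imp_permutes)
    have "inj_on \<sigma> A" by (rule inj_onI) (simp add: \<sigma>_def inj_eq[OF inj])
    moreover have "\<sigma> ` A \<subseteq> A"
    proof
      fix i assume "i \<in> \<sigma> ` A"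
      then obtain k where "k \<in> A" "i = \<theta> k" by (auto simp: \<sigma>_def)
      then show "i \<in> A" using wing[of k] by (simp only: A_def)
    qed
    moreover have "finite A" by (simp add: A_def)
    ultimately show "bij_betw \<sigma> A A" by (simp add: bij_betw_def endo_inj_surj)
  qed (simp add: \<sigma>_def)
  then have \<sigma>: "\<sigma> \<in> S3" by (simp add: A_def)
  have vals: "\<theta> 1 = \<sigma> 1" "\<theta> 2 = \<sigma> 1 + 1" "\<theta> 3 = \<sigma> 3" "\<theta> 4 = \<sigma> 3 + 1" "\<theta> 5 = \<sigma> 5" "\<theta> 6 = \<sigma> 5 + 1"
    using wing[of 1] wing[of 3] wing[of 5] by (simp_all add: \<sigma>_def A_def)
  have "\<theta> 0 \<in> {0, 1, 2, 3, 4, 5, 6}"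
    using permutes_in_image[OF assms(1), of 0] by (simp add: X7_vertices_def)
  moreover have "\<theta> 0 \<noteq> \<theta> 1" "\<theta> 0 \<noteq> \<theta> 2" "\<theta> 0 \<noteq> \<theta> 3" "\<theta> 0 \<noteq> \<theta> 4" "\<theta> 0 \<noteq> \<theta> 5" "\<theta> 0 \<noteq> \<theta> 6"
    by (simp_all add: inj_eq[OF inj])
  ultimately have "\<theta> 0 = 0"
    using S3_cases[OF \<sigma>] unfolding vals by (elim disjE conjE) simp_all
  have "\<theta> = S3_extend \<sigma>"
  proof
    fix i show "\<theta> i = S3_extend \<sigma> i"
      using vals \<open>\<theta> 0 = 0\<close> permutes_not_in[OF assms(1), of i] S3_extend_outside[of i \<sigma>]
      by (cases "i \<in> X7_vertices") (auto simp: X7_vertices_def)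
  qed
  with \<sigma> show ?thesis by blast
qed

text \<open>All arrows of \<open>Y\<close> are simple, while \<open>X\<^sub>7\<close> has a double arrow; so no relabelling of \<open>Y\<close> is \<open>X\<^sub>7\<close>.\<close>

lemma not_X7_model:
  assumes "\<theta> permutes X7_vertices"
  shows "\<exists>i j. model False (\<theta> i) (\<theta> j) \<noteq> X7_matrix i j"
proof -
  have "\<forall>i\<in>X7_vertices. \<forall>j\<in>X7_vertices. model False i j \<noteq> 2"
    unfolding all_vertices by (simp add: model_def mutate_def X7_matrix_def X7_arrows_def)
  then have "model False (\<theta> 1) (\<theta> 2) \<noteq> 2" using model_outside by (metis zero_neq_numeral)
  moreover have "X7_matrix 1 2 = 2" by (simp add: X7_matrix_def X7_arrows_def)
  ultimately show ?thesis by metis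
qed



section \<open>The presented group\<close>

abbreviation X7_presented :: "X7_gen signed_word set monoid" where
  "X7_presented \<equiv> presented_group X7_gens X7_relation"

abbreviation pmult (infixl "\<cdot>" 70) where
  "a \<cdot> b \<equiv> a \<otimes>\<^bsub>X7_presented\<^esub> b"
abbreviation pinv where "pinv a \<equiv> inv\<^bsub>X7_presented\<^esub> a"
abbreviation pone where "pone \<equiv> \<one>\<^bsub>X7_presented\<^esub>"

definition word_class :: "X7_gen signed_word \<Rightarrow> X7_gen signed_word set" where
  "word_class u = pres_equiv X7_gens X7_relation `` {u}"

interpretation P: word_congruence "signed_words X7_gens" "pres_equiv X7_gens X7_relation"
  by (rule word_congruence_pres)

interpretation P: group X7_presented
  unfolding presented_group_def by (rule P.group_word_quotient)

lemma word_class_eq_iff: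
  "u \<in> signed_words X7_gens \<Longrightarrow> v \<in> signed_words X7_gens \<Longrightarrow>
    word_class u = word_class v \<longleftrightarrow> (u, v) \<in> pres_equiv X7_gens X7_relation"
  unfolding word_class_def by (rule P.class_eq_iff)

lemma word_class_in [simp]: "u \<in> signed_words X7_gens \<Longrightarrow> word_class u \<in> carrier X7_presented"
  unfolding word_class_def presented_group_def by (rule P.class_in)

lemma word_class_Nil [simp]: "word_class [] = pone"
  by (simp add: word_class_def presented_group_def P.one_class)

lemma word_class_append:
  "u \<in> signed_words X7_gens \<Longrightarrow> v \<in> signed_words X7_gens \<Longrightarrow>
    word_class (u @ v) = word_class u \<cdot> word_class v"
  unfolding word_class_def presented_group_def by (rule P.mult_class[symmetric])

definition letter_class :: "X7_gen \<Rightarrow> X7_gen signed_word set" where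
  "letter_class x = word_class [(x, True)]"

lemma letter_class_in [simp]: "x \<in> X7_gens \<Longrightarrow> letter_class x \<in> carrier X7_presented"
  by (simp add: letter_class_def)

lemma word_class_letter:
  assumes "x \<in> X7_gens"
  shows "word_class [(x, b)] =
    (if b then letter_class x else pinv (letter_class x))"
proof -
  have "equivclp (pres_step X7_gens X7_relation) ([(x, False)] @ [(x, True)]) []"
    using signed_inverse_cancel[of "[(x, True)]" X7_gens X7_relation] assms by simp
  then have "pinv (letter_class x) = word_class [(x, False)]"
    unfolding letter_class_def word_class_def presented_group_def using assms
    by (intro P.inv_class) (simp_all add: pres_equiv_def)
  then show ?thesis by (cases b) (simp_all add: letter_class_def)
qed

lemma word_class_Cons:
  assumes "x \<in> X7_gens" "u \<in> signed_words X7_gens"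
  shows "word_class ((x, b) # u) =
    (if b then letter_class x else pinv (letter_class x))
      \<cdot> word_class u"
  using word_class_append[of "[(x, b)]" u] word_class_letter[of x b] assms by simp

lemma word_class_relation:
  assumes "X7_relation l r" "l \<in> signed_words X7_gens" "r \<in> signed_words X7_gens"
  shows "word_class l = word_class r"
proof -
  have "pres_step X7_gens X7_relation l r"
    using pres_step.relation[of X7_relation l r X7_gens "[]" "[]"] assms by simp
  then show ?thesis using assms by (auto simp: word_class_eq_iff pres_equiv_def)
qed

abbreviation "psi_cl k \<equiv> letter_class (Psi k)"
abbreviation "phi_cl k \<equiv> letter_class (Phi k)"
abbreviation "sig_cl \<sigma> \<equiv> letter_class (Sigma_perm \<sigma>)"

lemma gens_in [simp]:
  "k \<in> {1, 3, 5} \<Longrightarrow> Psi k \<in> X7_gens" "k \<in> {1, 3, 5} \<Longrightarrow> Phi k \<in> X7_gens"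
  "\<sigma> \<in> S3 \<Longrightarrow> Sigma_perm \<sigma> \<in> X7_gens"
  by (auto simp: X7_gens_def)

lemma transposition_in_S3 [simp]:
  "transpose 3 5 \<in> S3" "transpose 1 5 \<in> S3" "transpose 1 3 \<in> S3"
  by (auto intro: permutes_swap_id)

lemma cycle_in_S3 [simp]: "cycle_of_list [1, 5, 3] \<in> S3"
  using cycle_permutes[of "[1, 5, 3 :: nat]"] by (auto simp: insert_commute simp del: cycle_of_list.simps)

lemma id_in_S3 [simp]: "id \<in> S3"
  by (simp add: permutes_id)

lemma sig_cl_comp: "\<sigma> \<in> S3 \<Longrightarrow> \<tau> \<in> S3 \<Longrightarrow> sig_cl \<sigma> \<cdot> sig_cl \<tau> = sig_cl (\<sigma> \<circ> \<tau>)"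
  using word_class_relation[OF X7_relation.S3_table[of \<sigma> \<tau>]] permutes_compose[of \<tau> _ \<sigma>]
  by (simp add: word_class_Cons)

lemma sig_cl_id: "sig_cl id = pone"
  using sig_cl_comp[of id id] by (simp add: P.r_cancel_one)

lemma sig_cl_inv: "\<sigma> \<in> S3 \<Longrightarrow> sig_cl (Hilbert_Choice.inv \<sigma>) = pinv (sig_cl \<sigma>)"
  using sig_cl_comp[of "Hilbert_Choice.inv \<sigma>" \<sigma>] inv_in_S3[of \<sigma>]
  by (intro P.inv_equality[symmetric]) (simp_all add: permutes_inv_o sig_cl_id)

lemma sig_cl_psi:
  "\<sigma> \<in> S3 \<Longrightarrow> k \<in> {1, 3, 5} \<Longrightarrow>
    sig_cl \<sigma> \<cdot> psi_cl k \<cdot> pinv (sig_cl \<sigma>) = psi_cl (\<sigma> k)"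
  using word_class_relation[OF X7_relation.sig_psi[of \<sigma> k]] permutes_in_image[of \<sigma> "{1, 3, 5}" k]
  by (simp add: word_class_Cons P.m_assoc)

lemma sig_cl_phi:
  "\<sigma> \<in> S3 \<Longrightarrow> k \<in> {1, 3, 5} \<Longrightarrow>
    sig_cl \<sigma> \<cdot> phi_cl k \<cdot> pinv (sig_cl \<sigma>) = phi_cl (\<sigma> k)"
  using word_class_relation[OF X7_relation.sig_phi[of \<sigma> k]] permutes_in_image[of \<sigma> "{1, 3, 5}" k]
  by (simp add: word_class_Cons P.m_assoc)

lemma phi_cl_commute: "phi_cl 1 \<cdot> phi_cl 3 = phi_cl 3 \<cdot> phi_cl 1"
  using word_class_relation[OF X7_relation.phi_commute] by (simp add: word_class_Cons)

lemma phi_cl_psi: "phi_cl 1 = psi_cl 1 \<cdot> (psi_cl 1 \<cdot> sig_cl (transpose 3 5))"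
  using word_class_relation[OF X7_relation.phi_psi] transposition_in_S3(1)
  by (simp add: word_class_Cons del: mem_Collect_eq)

lemma psi_cl_square: "pinv (psi_cl 3) \<cdot> (psi_cl 1 \<cdot>
    (pinv (psi_cl 3) \<cdot> psi_cl 1)) = pone"
  using word_class_relation[OF X7_relation.psi_square] by (simp add: word_class_Cons)

lemma psi_cl_five: "sig_cl (cycle_of_list [1, 5, 3]) \<cdot> (psi_cl 5 \<cdot>
    (psi_cl 1 \<cdot> (psi_cl 3 \<cdot> (psi_cl 5 \<cdot> psi_cl 1))))
    = pone"
  using word_class_relation[OF X7_relation.psi_five] cycle_in_S3
  by (simp add: word_class_Cons del: mem_Collect_eq cycle_of_list.simps)

text \<open>Here \<open>p\<close>, \<open>t\<close>, \<open>f\<close> stand for \<open>\<psi>\<^sub>1\<close>, \<open>\<sigma>\<^sub>3\<^sub>5\<close>, \<open>\<phi>\<^sub>1\<close>. As \<open>t\<close> is an involution commuting with \<open>p\<close>, all three lie in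
an abelian subgroup in which \<open>f = p\<^sup>2t\<close>. The six identities are what the pentagon with corners
at \<open>X\<close> and \<open>Y\<close> gives when it is traversed from its various corners in both directions.\<close>

lemma (in group) pentagon_identities:
  assumes [simp]: "p \<in> carrier G" "t \<in> carrier G"
    and tt: "t \<otimes> t = \<one>" and tp: "t \<otimes> p = p \<otimes> t" and f: "f = p \<otimes> (p \<otimes> t)"
  shows "t \<otimes> (inv f \<otimes> (p \<otimes> p)) = \<one>" "t \<otimes> (p \<otimes> (p \<otimes> inv f)) = \<one>" "t \<otimes> (p \<otimes> (inv f \<otimes> p)) = \<one>"
    "t \<otimes> (f \<otimes> (inv p \<otimes> inv p)) = \<one>" "t \<otimes> (inv p \<otimes> (inv p \<otimes> f)) = \<one>"
    "t \<otimes> (inv p \<otimes> (f \<otimes> inv p)) = \<one>"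
proof -
  have cancel: "p \<otimes> (inv p \<otimes> z) = z" "inv p \<otimes> (p \<otimes> z) = z" "t \<otimes> (t \<otimes> z) = z"
    if "z \<in> carrier G" for z
    using that tt by (simp_all flip: m_assoc)
  have t_inv: "inv t = t" using tt by (simp add: inv_equality)
  have tp': "t \<otimes> inv p = inv p \<otimes> t"
    using tp by (metis assms(1,2) inv_closed inv_mult_group t_inv)
  have push: "t \<otimes> (p \<otimes> z) = p \<otimes> (t \<otimes> z)" "t \<otimes> (inv p \<otimes> z) = inv p \<otimes> (t \<otimes> z)"
    if "z \<in> carrier G" for z
    using that tp tp' by (simp_all flip: m_assoc)
  show "t \<otimes> (inv f \<otimes> (p \<otimes> p)) = \<one>" "t \<otimes> (p \<otimes> (p \<otimes> inv f)) = \<one>" "t \<otimes> (p \<otimes> (inv f \<otimes> p)) = \<one>"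
    "t \<otimes> (f \<otimes> (inv p \<otimes> inv p)) = \<one>" "t \<otimes> (inv p \<otimes> (inv p \<otimes> f)) = \<one>"
    "t \<otimes> (inv p \<otimes> (f \<otimes> inv p)) = \<one>"
    by (simp_all add: f inv_mult_group m_assoc cancel push t_inv tt tp tp')
qed

lemma (in group) inv_commute:
  assumes "a \<in> carrier G" "b \<in> carrier G" "a \<otimes> b = b \<otimes> a"
  shows "inv a \<otimes> b = b \<otimes> inv a"
  using assms by (metis inv_closed inv_solve_left inv_solve_right m_assoc m_closed)

lemma sig_cl_swap_psi:
  "sig_cl (transpose 3 5) \<cdot> psi_cl 1 = psi_cl 1 \<cdot> sig_cl (transpose 3 5)"
  using sig_cl_psi[OF transposition_in_S3(1), of 1] transposition_in_S3(1)
  by (simp add: P.inv_solve_right' del: mem_Collect_eq)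

lemma sig_cl_swap_swap:
  "sig_cl (transpose 3 5) \<cdot> sig_cl (transpose 3 5) = pone"
  using sig_cl_comp[OF transposition_in_S3(1) transposition_in_S3(1)] by (simp add: sig_cl_id)

lemmas X7_pentagons = P.pentagon_identities[OF
  letter_class_in[OF gens_in(1)[OF insertI1]] letter_class_in[OF gens_in(3)[OF transposition_in_S3(1)]]
  sig_cl_swap_swap sig_cl_swap_psi phi_cl_psi]

text \<open>The relation says that \<open>\<psi>\<^sub>3\<inverse>\<psi>\<^sub>1\<close> is its own inverse; conjugating by \<open>\<psi>\<^sub>3\<close>, so is \<open>\<psi>\<^sub>1\<psi>\<^sub>3\<inverse>\<close>.\<close>

lemma psi_cl_square_inverse:
  "pinv (psi_cl 1) \<cdot> psi_cl 3 = pinv (psi_cl 3) \<cdot> psi_cl 1"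
  "psi_cl 1 \<cdot> pinv (psi_cl 3) = psi_cl 3 \<cdot> pinv (psi_cl 1)"
proof -
  have [simp]: "psi_cl 1 \<in> carrier X7_presented" "psi_cl 3 \<in> carrier X7_presented" by simp_all
  have "pinv (pinv (psi_cl 3) \<cdot> psi_cl 1)
      = pinv (psi_cl 3) \<cdot> psi_cl 1"
    using psi_cl_square by (intro P.inv_equality) (simp_all add: P.m_assoc)
  then show "pinv (psi_cl 1) \<cdot> psi_cl 3 = pinv (psi_cl 3) \<cdot> psi_cl 1"
    by (simp add: P.inv_mult_group)
  then show "psi_cl 1 \<cdot> pinv (psi_cl 3) = psi_cl 3 \<cdot> pinv (psi_cl 1)"
    by (metis P.inv_closed P.inv_solve_left' P.inv_solve_right' P.m_assoc P.m_closed
        \<open>psi_cl 1 \<in> carrier X7_presented\<close> \<open>psi_cl 3 \<in> carrier X7_presented\<close>)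
qed


lemma sig_cl_push:
  assumes "\<sigma> \<in> S3" "k \<in> {1, 3, 5}" "z \<in> carrier X7_presented"
  shows "sig_cl \<sigma> \<cdot> (psi_cl k \<cdot> z) = psi_cl (\<sigma> k) \<cdot> (sig_cl \<sigma> \<cdot> z)"
proof -
  have "psi_cl (\<sigma> k) \<cdot> sig_cl \<sigma> = sig_cl \<sigma> \<cdot> psi_cl k"
    using sig_cl_psi[OF assms(1,2)] assms by (simp add: P.m_assoc flip: sig_cl_psi del: mem_Collect_eq insert_iff)
  then show ?thesis
    using assms permutes_in_image[of \<sigma> "{1, 3, 5}" k]
    by (simp flip: P.m_assoc del: insert_iff)
qed

text \<open>Conjugating the relation by the transposition of 1 and 5 inverts the 3-cycle and turns the word
in the \<open>\<psi>\<^sub>k\<close> into its own reversal; taking inverses then restores the 3-cycle and replaces every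
\<open>\<psi>\<^sub>k\<close> by its inverse. This is the pentagon inside \<open>Y\<close> traversed in the opposite direction.\<close>

lemma psi_cl_five_inverse:
  "sig_cl (cycle_of_list [1, 5, 3]) \<cdot>
    (pinv (psi_cl 5) \<cdot> (pinv (psi_cl 1) \<cdot> (pinv (psi_cl 3) \<cdot> (pinv (psi_cl 5) \<cdot> pinv (psi_cl 1))))) = pone"
proof -
  define c d r where "c = cycle_of_list [1, 5, 3 :: nat]" and "d = Hilbert_Choice.inv c"
    and "r = transpose 1 (5 :: nat)"
  have in_S3: "c \<in> S3" "d \<in> S3" "r \<in> S3"
    using cycle_in_S3 inv_in_S3 transposition_in_S3 unfolding c_def d_def r_def by blast+
  have [simp]: "Psi 1 \<in> X7_gens" "Psi 3 \<in> X7_gens" "Psi 5 \<in> X7_gens" by simp_all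
  have [simp]: "sig_cl c \<in> carrier X7_presented" "sig_cl d \<in> carrier X7_presented" "sig_cl r \<in> carrier X7_presented"
    using in_S3 by (simp_all del: mem_Collect_eq)
  have "d \<circ> r = r \<circ> c"
  proof -
    \<comment> \<open>Conjugation by the transposition \<open>r\<close> inverts the 3-cycle \<open>c\<close>.\<close>
    have "r = c \<circ> (r \<circ> c)" by (auto simp: c_def r_def transpose_def)
    moreover have "d \<circ> (c \<circ> (r \<circ> c)) = r \<circ> c"
      using in_S3(1) permutes_inverses(2)[of c "{1, 3, 5}"] by (simp add: d_def fun_eq_iff)
    ultimately show ?thesis by simp
  qed
  then have dr: "sig_cl r \<cdot> sig_cl c = sig_cl d \<cdot> sig_cl r"
    using sig_cl_comp in_S3 by metis
  let ?w = "psi_cl 1 \<cdot> (psi_cl 5 \<cdot> (psi_cl 3 \<cdot> (psi_cl 1 \<cdot> psi_cl 5)))"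
  have r_simps: "r 1 = 5" "r 5 = 1" "r 3 = 3" by (simp_all add: r_def)
  then have r: "sig_cl r \<cdot> psi_cl 5 = psi_cl 1 \<cdot> sig_cl r" "sig_cl r \<cdot> psi_cl 1 = psi_cl 5 \<cdot> sig_cl r"
    using sig_cl_push[OF in_S3(3), of 5 pone] sig_cl_push[OF in_S3(3), of 1 pone] by simp_all
  have "sig_cl r \<cdot> (sig_cl c \<cdot> (psi_cl 5 \<cdot> (psi_cl 1 \<cdot> (psi_cl 3 \<cdot> (psi_cl 5 \<cdot> psi_cl 1))))) = sig_cl r"
    using psi_cl_five by (simp add: c_def)
  also have "sig_cl r \<cdot> (sig_cl c \<cdot> (psi_cl 5 \<cdot> (psi_cl 1 \<cdot> (psi_cl 3 \<cdot> (psi_cl 5 \<cdot> psi_cl 1))))) = sig_cl d \<cdot> ?w \<cdot> sig_cl r"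
    using dr in_S3(3) by (simp add: sig_cl_push r r_simps P.m_assoc del: mem_Collect_eq flip: P.m_assoc[of "sig_cl r" "sig_cl c"])
  finally have "sig_cl d \<cdot> ?w = pone"
    by (simp add: P.r_cancel_one)
  then have "pinv (sig_cl d) = ?w"
    by (intro P.inv_equality P.inv_comm[of "sig_cl d" ?w]) simp_all
  moreover have "pinv (sig_cl d) = sig_cl c"
    using sig_cl_inv[OF in_S3(1)] in_S3 by (simp add: d_def P.inv_inv)
  ultimately have "sig_cl c \<cdot> pinv ?w = pone" by simp
  then show ?thesis by (simp add: c_def P.inv_mult_group P.m_assoc)
qed

lemma phi_cl_commute_inverses:
  "phi_cl 1 \<cdot> pinv (phi_cl 3) = pinv (phi_cl 3) \<cdot> phi_cl 1" "pinv (phi_cl 1) \<cdot> phi_cl 3 = phi_cl 3 \<cdot> pinv (phi_cl 1)"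
  "pinv (phi_cl 1) \<cdot> pinv (phi_cl 3) = pinv (phi_cl 3) \<cdot> pinv (phi_cl 1)"
proof -
  have [simp]: "phi_cl 1 \<in> carrier X7_presented" "phi_cl 3 \<in> carrier X7_presented" by simp_all
  show "phi_cl 1 \<cdot> pinv (phi_cl 3) = pinv (phi_cl 3) \<cdot> phi_cl 1"
    using P.inv_commute[of "phi_cl 3" "phi_cl 1"] phi_cl_commute by simp
  then show "pinv (phi_cl 1) \<cdot> pinv (phi_cl 3) = pinv (phi_cl 3) \<cdot> pinv (phi_cl 1)"
    using P.inv_commute[of "phi_cl 1" "pinv (phi_cl 3)"] by simp
  show "pinv (phi_cl 1) \<cdot> phi_cl 3 = phi_cl 3 \<cdot> pinv (phi_cl 1)"
    using P.inv_commute[of "phi_cl 1" "phi_cl 3"] phi_cl_commute by simp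
qed

text \<open>The relations that conjugate \<open>\<psi>\<^sub>k\<close> and \<open>\<phi>\<^sub>k\<close> by \<open>\<S>\<^sub>3\<close> say that the word spelled by a mutation is
equivariant, as the relabelling is.\<close>

lemma coeff_S3:
  assumes "\<sigma> \<in> S3" "j \<in> X7_vertices"
  shows "word_class (coeff x (S3_extend \<sigma> j)) \<cdot> sig_cl \<sigma> = sig_cl \<sigma> \<cdot> word_class (coeff x j)"
proof (cases "j = 0")
  case True
  then show ?thesis using assms by (simp add: coeff_def del: mem_Collect_eq)
next
  case False
  define k where "k = wing j"
  have k: "k \<in> {1, 3, 5}" by (auto simp: k_def wing_def)
  then have \<sigma>k: "\<sigma> k \<in> {1, 3, 5}" using assms by (simp only: mem_Collect_eq permutes_in_image)
  have *: "wing (S3_extend \<sigma> j) = \<sigma> k" "odd (S3_extend \<sigma> j) = odd j" "S3_extend \<sigma> j \<noteq> 0"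
    using S3_cases[OF assms(1)] assms(2) False unfolding k_def X7_vertices_def
    by (auto simp: wing_def)
  define a b where "a = (if x then Phi k else Psi k)" and "b = (if x then Phi (\<sigma> k) else Psi (\<sigma> k))"
  have in_gens: "a \<in> X7_gens" "b \<in> X7_gens"
    using k \<sigma>k by (simp_all add: a_def b_def del: insert_iff)
  then have [simp]: "letter_class a \<in> carrier X7_presented" "letter_class b \<in> carrier X7_presented"
    "sig_cl \<sigma> \<in> carrier X7_presented" using assms(1) by (simp_all del: mem_Collect_eq)
  have "letter_class b = sig_cl \<sigma> \<cdot> letter_class a \<cdot> pinv (sig_cl \<sigma>)"
    using sig_cl_psi[OF assms(1) k] sig_cl_phi[OF assms(1) k] by (simp add: a_def b_def)
  moreover from this have "pinv (letter_class b) = sig_cl \<sigma> \<cdot> pinv (letter_class a) \<cdot> pinv (sig_cl \<sigma>)"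
    by (simp add: P.inv_mult_group P.m_assoc)
  ultimately have "word_class [(b, odd j)] \<cdot> sig_cl \<sigma> = sig_cl \<sigma> \<cdot> word_class [(a, odd j)]"
    using in_gens by (simp add: word_class_letter P.m_assoc)
  moreover have "coeff x (S3_extend \<sigma> j) = [(b, odd j)]" "coeff x j = [(a, odd j)]"
    using * False by (simp_all add: coeff_def a_def b_def k_def)
  ultimately show ?thesis by simp
qed



section \<open>The action of mutation sequences on charts\<close>

text \<open>A chart \<open>(x, \<theta>, g)\<close> describes a stage of a mutation sequence: the current matrix is the model \<open>x\<close>
pulled back along \<open>\<theta>\<close>, which sends current labels to labels of the model, and \<open>g\<close> is the word
spelled so far. New letters are added on the left because sequences are applied from right
to left.\<close>

type_synonym chart = "bool \<times> (nat \<Rightarrow> nat) \<times> X7_gen signed_word"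

fun move_chart :: "nat move \<Rightarrow> chart \<Rightarrow> chart" where
  "move_chart (Mut k) (x, \<theta>, g) = (target x (\<theta> k), relabel x (\<theta> k) \<circ> \<theta>, coeff x (\<theta> k) @ g)"
| "move_chart (Perm \<sigma>) (x, \<theta>, g) = (x, \<theta> \<circ> Hilbert_Choice.inv \<sigma>, g)"

definition run :: "nat move list \<Rightarrow> chart \<Rightarrow> chart" where
  "run w = foldr move_chart w"

lemma run_simps [simp]:
  "run [] S = S" "run (m # w) S = move_chart m (run w S)" "run (u @ w) S = run u (run w S)"
  by (simp_all add: run_def)

fun valid_chart :: "chart \<Rightarrow> bool" where
  "valid_chart (x, \<theta>, g) \<longleftrightarrow> \<theta> permutes X7_vertices \<and> g \<in> signed_words X7_gens"

fun chart_matrix :: "chart \<Rightarrow> nat matrix" where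
  "chart_matrix (x, \<theta>, g) = (\<lambda>i j. model x (\<theta> i) (\<theta> j))"

text \<open>Composing the identification \<open>\<theta>\<close> with a symmetry of the model describes the same matrix; the word
changes by the same element of \<open>\<S>\<^sub>3\<close>.\<close>

fun same_chart :: "chart \<Rightarrow> chart \<Rightarrow> bool" where
  "same_chart (x, \<theta>, g) (x', \<theta>', g') \<longleftrightarrow>
     x' = x \<and> (\<exists>\<sigma>\<in>S3. \<theta>' = S3_extend \<sigma> \<circ> \<theta> \<and> word_class g' = sig_cl \<sigma> \<cdot> word_class g)"

lemma valid_run:
  assumes "w \<in> mutation_sequences X7_vertices" "valid_chart S"
  shows "valid_chart (run w S)"
  using assms(1)
proof (induction w)
  case (Cons m w)
  from Cons.prems have w: "w \<in> mutation_sequences X7_vertices" by (cases m) auto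
  obtain x \<theta> g where S': "run w S = (x, \<theta>, g)" by (metis prod_cases3)
  with Cons.IH[OF w] have "\<theta> permutes X7_vertices" "g \<in> signed_words X7_gens" by simp_all
  then show ?case
    using Cons.prems S' relabel_permutes coeff_in
    by (cases m) (auto intro: permutes_compose permutes_inv)
qed (use assms(2) in simp)

lemma chart_matrix_run:
  assumes "w \<in> mutation_sequences X7_vertices" "valid_chart S"
  shows "apply_seq w (chart_matrix S) = chart_matrix (run w S)"
  using assms(1)
proof (induction w)
  case (Cons m w)
  from Cons.prems have w: "w \<in> mutation_sequences X7_vertices" by (cases m) auto
  obtain x \<theta> g where S': "run w S = (x, \<theta>, g)" by (metis prod_cases3)
  then have \<theta>: "\<theta> permutes X7_vertices" using valid_run[OF w assms(2)] by simp
  show ?case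
  proof (cases m)
    case (Mut k)
    then have "\<theta> k \<in> X7_vertices" using Cons.prems \<theta> by (simp add: permutes_in_image)
    have "mutate k (\<lambda>i j. model x (\<theta> i) (\<theta> j)) i j = mutate (\<theta> k) (model x) (\<theta> i) (\<theta> j)" for i j
      using permutes_inj[OF \<theta>] by (simp add: mutate_def inj_eq)
    then show ?thesis
      using Mut Cons.IH[OF w] S' mutate_model[OF \<open>\<theta> k \<in> X7_vertices\<close>] by auto
  next
    case (Perm \<sigma>)
    then show ?thesis using Cons.IH[OF w] S' by (auto simp: permute_matrix_def)
  qed
qed simp

lemma same_chart_refl: "valid_chart S \<Longrightarrow> same_chart S S"
  by (cases S) (force simp: sig_cl_id permutes_id simp del: id_apply intro: exI[of _ id])

lemma same_chart_sym:
  assumes "same_chart S S'" "valid_chart S" shows "same_chart S' S"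
proof -
  obtain x \<theta> g where S: "S = (x, \<theta>, g)" by (metis prod_cases3)
  with assms(1) obtain \<sigma> \<theta>' g' where S': "S' = (x, \<theta>', g')" "\<theta>' = S3_extend \<sigma> \<circ> \<theta>"
    and \<sigma>: "\<sigma> \<in> S3" and g': "word_class g' = sig_cl \<sigma> \<cdot> word_class g"
    by (cases S') auto
  have in_P: "sig_cl \<sigma> \<in> carrier X7_presented" "word_class g \<in> carrier X7_presented"
    using \<sigma> assms(2) S by (simp_all del: mem_Collect_eq)
  have "word_class g = sig_cl (Hilbert_Choice.inv \<sigma>) \<cdot> word_class g'"
    using in_P by (simp add: g' sig_cl_inv[OF \<sigma>] flip: P.m_assoc)
  moreover have "S3_extend (Hilbert_Choice.inv \<sigma>) \<circ> \<theta>' = \<theta>"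
    using permutes_inv_o(2)[OF S3_extend_permutes[OF \<sigma>]]
    by (simp add: S' inv_S3_extend[OF \<sigma>, symmetric] o_assoc)
  ultimately show ?thesis
    using inv_in_S3[OF \<sigma>] by (auto simp: S S'(1) intro!: bexI[of _ "Hilbert_Choice.inv \<sigma>"])
qed

lemma same_chart_trans:
  assumes "same_chart S S'" "same_chart S' S''" "valid_chart S"
  shows "same_chart S S''"
proof -
  obtain x \<theta> g where S: "S = (x, \<theta>, g)" by (metis prod_cases3)
  with assms(1) obtain \<sigma> \<theta>' g' where S': "S' = (x, \<theta>', g')" "\<theta>' = S3_extend \<sigma> \<circ> \<theta>"
    and \<sigma>: "\<sigma> \<in> S3" and g': "word_class g' = sig_cl \<sigma> \<cdot> word_class g"
    by (cases S') auto
  with assms(2) obtain \<tau> \<theta>'' g'' where S'': "S'' = (x, \<theta>'', g'')" "\<theta>'' = S3_extend \<tau> \<circ> \<theta>'"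
    and \<tau>: "\<tau> \<in> S3" and g'': "word_class g'' = sig_cl \<tau> \<cdot> word_class g'"
    by (cases S'') auto
  have in_P: "sig_cl \<sigma> \<in> carrier X7_presented" "sig_cl \<tau> \<in> carrier X7_presented"
    "word_class g \<in> carrier X7_presented"
    using \<sigma> \<tau> assms(3) S by (simp_all del: mem_Collect_eq)
  have "word_class g'' = sig_cl (\<tau> \<circ> \<sigma>) \<cdot> word_class g"
    using in_P by (simp add: g'' g' P.m_assoc flip: sig_cl_comp[OF \<tau> \<sigma>])
  moreover have "\<theta>'' = S3_extend (\<tau> \<circ> \<sigma>) \<circ> \<theta>"
    by (simp add: S'' S' S3_extend_comp[OF \<sigma>] o_assoc)
  moreover have "\<tau> \<circ> \<sigma> \<in> S3" using \<sigma> \<tau> by (simp add: permutes_compose)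
  ultimately show ?thesis by (auto simp: S S''(1) intro!: bexI[of _ "\<tau> \<circ> \<sigma>"])
qed

lemma same_chart_matrix: "same_chart S S' \<Longrightarrow> chart_matrix S = chart_matrix S'"
  by (cases S; cases S') (auto simp: model_S3)

lemma same_chart_run:
  assumes "w \<in> mutation_sequences X7_vertices" "same_chart S S'" "valid_chart S" "valid_chart S'"
  shows "same_chart (run w S) (run w S')"
  using assms(1)
proof (induction w)
  case (Cons m w)
  from Cons.prems have w: "w \<in> mutation_sequences X7_vertices" by (cases m) auto
  obtain x \<theta> g where R: "run w S = (x, \<theta>, g)" by (metis prod_cases3)
  with Cons.IH[OF w] obtain \<sigma> \<theta>' g' where R': "run w S' = (x, \<theta>', g')" "\<theta>' = S3_extend \<sigma> \<circ> \<theta>"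
    and \<sigma>: "\<sigma> \<in> S3" and g': "word_class g' = sig_cl \<sigma> \<cdot> word_class g"
    by (cases "run w S'") auto
  have valid: "\<theta> permutes X7_vertices" "g \<in> signed_words X7_gens" "g' \<in> signed_words X7_gens"
    using valid_run[OF w assms(3)] valid_run[OF w assms(4)] R R' by simp_all
  show ?case
  proof (cases m)
    case (Mut k)
    let ?j = "\<theta> k"
    have j: "?j \<in> X7_vertices" using Cons.prems Mut valid by (simp add: permutes_in_image)
    have in_P: "sig_cl \<sigma> \<in> carrier X7_presented" using \<sigma> by (simp del: mem_Collect_eq)
    have "word_class (coeff x (S3_extend \<sigma> ?j) @ g') = sig_cl \<sigma> \<cdot> word_class (coeff x ?j @ g)"
      using coeff_S3[OF \<sigma> j, of x] in_P valid
      by (simp add: word_class_append coeff_in g' flip: P.m_assoc)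
    moreover have "relabel x (S3_extend \<sigma> ?j) \<circ> \<theta>' = S3_extend \<sigma> \<circ> (relabel x ?j \<circ> \<theta>)"
      using relabel_S3[OF \<sigma> j, of x] by (simp add: R' o_assoc)
    ultimately show ?thesis
      using \<sigma> target_S3[OF \<sigma> j] by (auto simp: Mut R R' intro!: bexI[of _ \<sigma>])
  next
    case (Perm \<tau>)
    then show ?thesis using \<sigma> g' by (auto simp: R R' o_assoc intro!: bexI[of _ \<sigma>])
  qed
qed (use assms in simp)

text \<open>Running a sequence from the chart with identification \<open>\<theta>\<close> amounts to running the sequence
with labels translated by \<open>\<theta>\<close> from the standard chart \<open>(x, id, [])\<close> of the model. So each relation
needs to be checked only at the two standard charts.\<close>

fun conj_move :: "(nat \<Rightarrow> nat) \<Rightarrow> nat move \<Rightarrow> nat move" where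
  "conj_move \<theta> (Mut k) = Mut (\<theta> k)"
| "conj_move \<theta> (Perm \<tau>) = Perm (\<theta> \<circ> \<tau> \<circ> Hilbert_Choice.inv \<theta>)"

fun translate :: "(nat \<Rightarrow> nat) \<Rightarrow> X7_gen signed_word \<Rightarrow> chart \<Rightarrow> chart" where
  "translate \<theta> g (x, \<eta>, c) = (x, \<eta> \<circ> \<theta>, c @ g)"

lemma conj_move_in:
  assumes "\<theta> permutes I" "w \<in> mutation_sequences I"
  shows "map (conj_move \<theta>) w \<in> mutation_sequences I"
  using assms(2)
proof (induction w)
  case (Cons m w)
  then show ?case using assms(1)
    by (cases m) (auto simp: permutes_in_image permutes_compose permutes_inv)
qed simp

lemma run_translate:
  assumes "\<theta> permutes X7_vertices" "w \<in> mutation_sequences X7_vertices"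
  shows "run w (x, \<theta>, g) = translate \<theta> g (run (map (conj_move \<theta>) w) (x, id, []))"
  using assms(2)
proof (induction w)
  case (Cons m w)
  from Cons.prems have w: "w \<in> mutation_sequences X7_vertices" by (cases m) auto
  obtain y \<eta> c where R: "run (map (conj_move \<theta>) w) (x, id, []) = (y, \<eta>, c)" by (metis prod_cases3)
  show ?case
  proof (cases m)
    case (Mut k)
    then show ?thesis using Cons.IH[OF w] R by (simp add: o_assoc id_def)
  next
    case (Perm \<tau>)
    then have "\<tau> permutes X7_vertices" using Cons.prems by simp
    then have "Hilbert_Choice.inv (\<theta> \<circ> \<tau> \<circ> Hilbert_Choice.inv \<theta>) \<circ> \<theta> = \<theta> \<circ> Hilbert_Choice.inv \<tau>"
      using assms(1)
      by (simp add: permutes_bij bij_is_inj bij_imp_bij_inv o_inv_distrib bij_comp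
          permutes_inv_inv permutes_inv_o comp_assoc)
    then show ?thesis using Perm Cons.IH[OF w] R by (simp add: comp_assoc id_def)
  qed
qed simp

lemma same_chart_translate:
  assumes "same_chart S S'" "valid_chart S" "valid_chart S'" "g \<in> signed_words X7_gens"
  shows "same_chart (translate \<theta> g S) (translate \<theta> g S')"
proof -
  obtain x \<eta> c where S: "S = (x, \<eta>, c)" by (metis prod_cases3)
  with assms(1) obtain \<sigma> \<eta>' c' where S': "S' = (x, \<eta>', c')" "\<eta>' = S3_extend \<sigma> \<circ> \<eta>"
    and \<sigma>: "\<sigma> \<in> S3" and c': "word_class c' = sig_cl \<sigma> \<cdot> word_class c"
    by (cases S') auto
  have "word_class (c' @ g) = sig_cl \<sigma> \<cdot> word_class (c @ g)"
    using assms \<sigma> S S' c' by (simp add: word_class_append P.m_assoc del: mem_Collect_eq)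
  then show ?thesis using \<sigma> by (auto simp: S S' o_assoc intro!: bexI[of _ \<sigma>])
qed



section \<open>Squares and pentagons\<close>

lemma S3_move_wings:
  assumes "k \<in> {1, 3, 5}" "l \<in> {1, 3, 5}"
  shows "\<exists>\<sigma>\<in>S3. \<sigma> k = 1 \<and> (l \<noteq> k \<longrightarrow> \<sigma> l = 3)"
proof -
  define c where "c = cycle_of_list [1, 5, 3 :: nat]"
  have c: "c \<in> S3" "Hilbert_Choice.inv c \<in> S3"
    using cycle_in_S3 inv_in_S3 unfolding c_def by blast+
  have c_simps: "c 3 = 1" "c 5 = 3" "c 1 = 5" by (simp_all add: c_def)
  then have inv_simps: "Hilbert_Choice.inv c 1 = 3" "Hilbert_Choice.inv c 5 = 1"
    using c(1) by (simp_all add: permutes_inv_eq)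
  consider "k = 1" "l \<noteq> 5" | "k = 1" "l = 5" | "k = 3" "l = 1" | "k = 3" "l \<noteq> 1"
    | "k = 5" "l = 1" | "k = 5" "l \<noteq> 1"
    using assms by auto
  then show ?thesis
  proof cases
    case 1
    then show ?thesis using assms(2) by (intro bexI[OF _ id_in_S3]) auto
  next
    case 2
    then show ?thesis by (intro bexI[OF _ transposition_in_S3(1)]) auto
  next
    case 3
    then show ?thesis by (intro bexI[OF _ transposition_in_S3(3)]) auto
  next
    case 4
    then show ?thesis using assms(2) c_simps by (intro bexI[OF _ c(1)]) auto
  next
    case 5
    then show ?thesis using inv_simps by (intro bexI[OF _ c(2)]) auto
  next
    case 6
    then show ?thesis using assms(2) by (intro bexI[OF _ transposition_in_S3(2)]) auto
  qed
qed

text \<open>Up to \<open>\<S>\<^sub>3\<close>, the first wing that occurs in a pair of vertices is \<open>{1,2}\<close> and a second one is \<open>{3,4}\<close>.\<close>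

definition canonical_pairs :: "(nat \<times> nat) set" where
  "canonical_pairs = {(0, 0), (0, 1), (0, 2), (1, 0), (2, 0), (1, 1), (1, 2), (2, 1), (2, 2),
     (1, 3), (1, 4), (2, 3), (2, 4)}"

lemma canonical_pair_ex:
  assumes "i \<in> X7_vertices" "j \<in> X7_vertices"
  shows "\<exists>\<sigma>\<in>S3. (S3_extend \<sigma> i, S3_extend \<sigma> j) \<in> canonical_pairs"
proof -
  \<comment> \<open>The wing to be moved to \<open>{1,2}\<close>.\<close>
  define k where "k = (if i = 0 then wing j else wing i)"
  have "k \<in> {1, 3, 5}" "wing j \<in> {1, 3, 5}" by (auto simp: k_def wing_def)
  then obtain \<sigma> where \<sigma>: "\<sigma> \<in> S3" "\<sigma> k = 1" "wing j \<noteq> k \<Longrightarrow> \<sigma> (wing j) = 3"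
    using S3_move_wings by blast
  have "\<forall>i\<in>X7_vertices. \<forall>j\<in>X7_vertices.
      \<sigma> (if i = 0 then wing j else wing i) = 1 \<longrightarrow>
      (wing j \<noteq> (if i = 0 then wing j else wing i) \<longrightarrow> \<sigma> (wing j) = 3) \<longrightarrow>
      (S3_extend \<sigma> i, S3_extend \<sigma> j) \<in> canonical_pairs"
    unfolding all_vertices by (simp add: wing_def canonical_pairs_def)
  then show ?thesis using \<sigma> assms unfolding k_def by blast
qed

lemma same_chartI:
  assumes "\<sigma> \<in> S3" "valid_chart S" "valid_chart S'" "fst S' = fst S"
    and eq: "\<forall>i\<in>X7_vertices. fst (snd S') i = S3_extend \<sigma> (fst (snd S) i)"
    and "word_class (snd (snd S')) = sig_cl \<sigma> \<cdot> word_class (snd (snd S))"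
  shows "same_chart S S'"
proof -
  obtain x \<theta> g where S: "S = (x, \<theta>, g)" by (metis prod_cases3)
  obtain x' \<theta>' g' where S': "S' = (x', \<theta>', g')" by (metis prod_cases3)
  have "\<theta>' = S3_extend \<sigma> \<circ> \<theta>"
  proof
    fix i show "\<theta>' i = (S3_extend \<sigma> \<circ> \<theta>) i"
      using eq assms(2,3) permutes_not_in[of \<theta> _ i] permutes_not_in[of \<theta>' _ i] S3_extend_outside[of i \<sigma>]
      by (cases "i \<in> X7_vertices") (auto simp: S S')
  qed
  then show ?thesis using assms by (auto simp: S S' intro!: bexI[of _ \<sigma>])
qed

lemma valid_start: "valid_chart (x, id, [])"
  by (simp add: permutes_id)

lemma valid_run_start:
  "w \<in> mutation_sequences X7_vertices \<Longrightarrow> valid_chart (run w (x, id, []))"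
  using valid_run valid_start by blast

lemmas chart_eval_simps = relabel_def wing_def coeff_def target_def all_vertices word_class_Cons

text \<open>The squares at \<open>X\<close> mutate two different wings, and the four choices of vertices give the
commutation of \<open>\<phi>\<^sub>1\<close> or its inverse with \<open>\<phi>\<^sub>3\<close> or its inverse. At \<open>Y\<close>, distinct vertices other than 0
are unconnected exactly if they have equal parity.\<close>

lemma square_canonical:
  assumes "(i, j) \<in> canonical_pairs" "model x i j = 0"
  shows "same_chart (run [Mut i, Mut j] (x, id, [])) (run [Mut j, Mut i] (x, id, []))"
proof -
  have in_V: "i \<in> X7_vertices" "j \<in> X7_vertices"
    using assms(1) by (auto simp: canonical_pairs_def X7_vertices_def)
  have "i = j \<or> (i, j) \<in> {(1, 3), (2, 4)} \<or> x \<and> (i, j) \<in> {(1, 4), (2, 3)}"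
    using assms
    by (cases x) (auto simp: canonical_pairs_def model_def mutate_def X7_matrix_def X7_arrows_def)
  then consider "i = j" | "x" "i = 1" "j = 3" | "x" "i = 2" "j = 4" | "x" "i = 1" "j = 4"
    | "x" "i = 2" "j = 3" | "\<not> x" "i = 1" "j = 3" | "\<not> x" "i = 2" "j = 4"
    by auto
  then show ?thesis
  proof cases
    case 1
    then show ?thesis
      using in_V same_chart_refl[OF valid_run_start] by (simp del: run_simps same_chart.simps)
  qed (rule same_chartI[OF id_in_S3 valid_run_start valid_run_start];
      simp add: chart_eval_simps sig_cl_id phi_cl_commute phi_cl_commute_inverses psi_cl_square_inverse in_V X7_vertices_def)+
qed

lemma model_pm1:
  assumes "(i, j) \<in> canonical_pairs" "model x i j = 1 \<or> model x i j = -1"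
  shows "(i, j) \<in> {(0, 1), (0, 2), (1, 0), (2, 0)} \<or> \<not> x \<and> (i, j) \<in> {(1, 2), (2, 1), (1, 4), (2, 3)}"
  using assms
  by (cases x) (auto simp: canonical_pairs_def model_def mutate_def X7_matrix_def X7_arrows_def)

text \<open>The pairs \<open>(1, 4)\<close> and \<open>(2, 3)\<close> are corners of the pentagon inside \<open>Y\<close>, which closes up to a 3-cycle
of the wings. All other pairs that occur are corners of the pentagon through \<open>X\<close> and \<open>Y\<close>, which
closes up to \<open>\<sigma>\<^sub>3\<^sub>5\<close>.\<close>

lemma pentagon_canonical:
  assumes "(i, j) \<in> canonical_pairs" "model x i j = 1 \<or> model x i j = -1"
  shows "same_chart (run [Mut i, Mut j, Mut i, Mut j, Mut i] (x, id, []))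
    (run [Perm (transpose i j)] (x, id, []))"
proof -
  have in_V: "i \<in> X7_vertices" "j \<in> X7_vertices"
    using assms(1) by (auto simp: canonical_pairs_def X7_vertices_def)
  then have valid: "valid_chart (run [Mut i, Mut j, Mut i, Mut j, Mut i] (x, id, []))"
    "valid_chart (run [Perm (transpose i j)] (x, id, []))"
    by (auto intro!: valid_run_start permutes_swap_id simp del: run_simps)
  note in_S3 = transposition_in_S3(1) and eval = chart_eval_simps X7_pentagons
  have "i = 0 \<and> j = 1 \<or> i = 0 \<and> j = 2 \<or> i = 1 \<and> j = 0 \<or> i = 2 \<and> j = 0
      \<or> \<not> x \<and> i = 1 \<and> j = 2 \<or> \<not> x \<and> i = 2 \<and> j = 1
      \<or> \<not> x \<and> i = 1 \<and> j = 4 \<or> \<not> x \<and> i = 2 \<and> j = 3"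
    using model_pm1[OF assms] by auto
  then consider "i = 0" "j = 1" | "i = 0" "j = 2" | "i = 1" "j = 0" | "i = 2" "j = 0"
    | "\<not> x" "i = 1" "j = 2" | "\<not> x" "i = 2" "j = 1" | "\<not> x" "i = 1" "j = 4" | "\<not> x" "i = 2" "j = 3"
    by blast
  then show ?thesis
  proof cases
    case 1
    then show ?thesis by (cases x; intro same_chartI[OF in_S3 valid]; simp add: eval)
  next
    case 2
    then show ?thesis by (cases x; intro same_chartI[OF in_S3 valid]; simp add: eval)
  next
    case 3
    then show ?thesis by (cases x; intro same_chartI[OF in_S3 valid]; simp add: eval)
  next
    case 4
    then show ?thesis by (cases x; intro same_chartI[OF in_S3 valid]; simp add: eval)
  next
    case 5
    then show ?thesis by (intro same_chartI[OF in_S3 valid]; simp add: eval)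
  next
    case 6
    then show ?thesis by (intro same_chartI[OF in_S3 valid]; simp add: eval)
  next
    case 7
    then show ?thesis using psi_cl_five by (intro same_chartI[OF cycle_in_S3 valid]; simp add: eval)
  next
    case 8
    then show ?thesis using psi_cl_five_inverse by (intro same_chartI[OF cycle_in_S3 valid]; simp add: eval)
  qed
qed



section \<open>The action respects the defining relations\<close>

lemma same_chart_run_translate:
  assumes "\<theta> permutes X7_vertices" "g \<in> signed_words X7_gens"
    and lr: "l \<in> mutation_sequences X7_vertices" "r \<in> mutation_sequences X7_vertices"
    and "same_chart (run (map (conj_move \<theta>) l) (x, id, [])) (run (map (conj_move \<theta>) r) (x, id, []))"
  shows "same_chart (run l (x, \<theta>, g)) (run r (x, \<theta>, g))"
  unfolding run_translate[OF assms(1) lr(1)] run_translate[OF assms(1) lr(2)]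
  by (intro same_chart_translate assms valid_run_start conj_move_in)

text \<open>The standard chart is the same as the one twisted by \<open>\<sigma>\<close>, so a relation may be transported by \<open>\<sigma>\<close>
to a pair of labels that suits.\<close>

lemma same_chart_run_S3:
  assumes \<sigma>: "\<sigma> \<in> S3"
    and lr: "l \<in> mutation_sequences X7_vertices" "r \<in> mutation_sequences X7_vertices"
    and "same_chart (run (map (conj_move (S3_extend \<sigma>)) l) (x, id, []))
      (run (map (conj_move (S3_extend \<sigma>)) r) (x, id, []))"
  shows "same_chart (run l (x, id, [])) (run r (x, id, []))"
proof -
  let ?S = "(x, id, [])" and ?T = "(x, S3_extend \<sigma>, [(Sigma_perm \<sigma>, True)])"
  have T: "valid_chart ?T" using \<sigma> by (simp add: S3_extend_permutes del: mem_Collect_eq)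
  have S: "valid_chart ?S" by (rule valid_start)
  have "word_class [(Sigma_perm \<sigma>, True)] = sig_cl \<sigma> \<cdot> word_class []"
    using \<sigma> by (simp add: word_class_Cons del: mem_Collect_eq)
  then have ST: "same_chart ?S ?T" using \<sigma> by auto
  have "same_chart (run l ?S) (run l ?T)" by (rule same_chart_run[OF lr(1) ST S T])
  moreover have "same_chart (run l ?T) (run r ?T)"
    using T by (intro same_chart_run_translate[OF _ _ lr assms(4)]) simp_all
  moreover have "same_chart (run r ?T) (run r ?S)"
    using same_chart_run[OF lr(2) ST S T] same_chart_sym valid_run[OF lr(2) S] by blast
  ultimately show ?thesis
    using same_chart_trans valid_run[OF lr(1) S] valid_run[OF lr(1) T] by blast
qed

lemma square_start:
  assumes "i \<in> X7_vertices" "j \<in> X7_vertices" "model x i j = 0"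
  shows "same_chart (run [Mut i, Mut j] (x, id, [])) (run [Mut j, Mut i] (x, id, []))"
proof -
  obtain \<sigma> where \<sigma>: "\<sigma> \<in> S3" "(S3_extend \<sigma> i, S3_extend \<sigma> j) \<in> canonical_pairs"
    using canonical_pair_ex[OF assms(1,2)] by blast
  show ?thesis
  proof (rule same_chart_run_S3[OF \<sigma>(1)])
    show "same_chart (run (map (conj_move (S3_extend \<sigma>)) [Mut i, Mut j]) (x, id, []))
        (run (map (conj_move (S3_extend \<sigma>)) [Mut j, Mut i]) (x, id, []))"
      using assms square_canonical[OF \<sigma>(2), of x] model_S3[OF \<sigma>(1), of x i j]
      by (simp del: run_simps)
  qed (use assms in simp_all)
qed

lemma conj_transpose: "bij \<theta> \<Longrightarrow> \<theta> \<circ> transpose i j \<circ> Hilbert_Choice.inv \<theta> = transpose (\<theta> i) (\<theta> j)"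
  by (auto simp: fun_eq_iff transpose_def bij_is_inj bij_is_surj surj_f_inv_f)

lemma pentagon_start:
  assumes "i \<in> X7_vertices" "j \<in> X7_vertices" "model x i j = 1 \<or> model x i j = -1"
  shows "same_chart (run [Mut i, Mut j, Mut i, Mut j, Mut i] (x, id, []))
    (run [Perm (transpose i j)] (x, id, []))"
proof -
  obtain \<sigma> where \<sigma>: "\<sigma> \<in> S3" "(S3_extend \<sigma> i, S3_extend \<sigma> j) \<in> canonical_pairs"
    using canonical_pair_ex[OF assms(1,2)] by blast
  have "bij (S3_extend \<sigma>)" using S3_extend_permutes[OF \<sigma>(1)] by (rule permutes_bij)
  then have conj: "map (conj_move (S3_extend \<sigma>)) [Perm (transpose i j)] =
      [Perm (transpose (S3_extend \<sigma> i) (S3_extend \<sigma> j))]"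
    by (simp add: conj_transpose)
  show ?thesis
  proof (rule same_chart_run_S3[OF \<sigma>(1)])
    show "same_chart (run (map (conj_move (S3_extend \<sigma>)) [Mut i, Mut j, Mut i, Mut j, Mut i]) (x, id, []))
        (run (map (conj_move (S3_extend \<sigma>)) [Perm (transpose i j)]) (x, id, []))"
      unfolding conj
      using assms pentagon_canonical[OF \<sigma>(2), of x] model_S3[OF \<sigma>(1), of x i j]
      by (simp del: run_simps)
  qed (use assms in \<open>simp_all add: permutes_swap_id\<close>)
qed

lemma involution_start:
  assumes "k \<in> X7_vertices"
  shows "same_chart (run [Mut k, Mut k] (x, id, [])) (run [] (x, id, []))"
proof -
  have "valid_chart (run [Mut k, Mut k] (x, id, []))" "valid_chart (run [] (x, id, []))"
    using assms by (auto intro!: valid_run_start simp del: run_simps)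
  note I = same_chartI[OF id_in_S3 this]
  have "k = 0 \<or> k = 1 \<or> k = 2 \<or> k = 3 \<or> k = 4 \<or> k = 5 \<or> k = 6"
    using assms by (simp add: X7_vertices_def)
  then show ?thesis
    by (elim disjE; cases x; intro I; simp add: chart_eval_simps sig_cl_id)
qed

lemma mut_relation_in:
  assumes "mut_relation I \<epsilon> l r"
  shows "l \<in> mutation_sequences I" "r \<in> mutation_sequences I"
  using assms
  by (cases; auto simp: permutes_id permutes_inv permutes_compose permutes_in_image permutes_swap_id)+

text \<open>The checks at the standard charts carry over to all charts by translation. So the presented
group has relations enough for the word spelled by a mutation sequence to depend only on the
equivalence class of the sequence, up to the symmetries of the model.\<close>

lemma run_relation:
  assumes "mut_relation X7_vertices (chart_matrix S) l r" "valid_chart S"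
  shows "same_chart (run l S) (run r S)"
proof -
  obtain x \<theta> g where S: "S = (x, \<theta>, g)" by (metis prod_cases3)
  have \<theta>: "\<theta> permutes X7_vertices" and g: "g \<in> signed_words X7_gens" using assms(2) S by simp_all
  note in_seqs = mut_relation_in[OF assms(1)]
  note translate = same_chart_run_translate[OF \<theta> g in_seqs]
  have refl: "same_chart (run l S) (run r S)" if "run l S = run r S"
    using that same_chart_refl[OF valid_run[OF in_seqs(1) assms(2)]] by simp
  show ?thesis using assms(1)
  proof cases
    case perm_id
    then show ?thesis by (intro refl) (simp add: S)
  next
    case (perm_comp \<sigma> \<tau>)
    then show ?thesis
      by (intro refl) (simp add: S o_inv_distrib permutes_bij o_assoc)
  next
    case (involution k)
    then show ?thesis
      unfolding S by (intro translate) (simp add: involution_start \<theta> permutes_in_image del: run_simps)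
  next
    case (conjugation \<sigma> k)
    then have "\<theta> \<circ> \<sigma> \<circ> Hilbert_Choice.inv \<sigma> = \<theta>" by (simp add: comp_assoc permutes_inv_o)
    then show ?thesis
      using conjugation by (intro refl) (simp add: S permutes_inv_inv comp_assoc)
  next
    case (square i j)
    then show ?thesis
      using square_start[of "\<theta> i" "\<theta> j" x] \<theta> unfolding S
      by (intro translate) (simp add: S permutes_in_image del: run_simps)
  next
    case (pentagon i j)
    then show ?thesis
      using pentagon_start[of "\<theta> i" "\<theta> j" x] \<theta> unfolding S
      by (intro translate)
        (simp add: S permutes_in_image conj_transpose permutes_bij del: run_simps)
  qed
qed



lemma run_step:
  assumes "mut_step X7_vertices (chart_matrix S) u v" "valid_chart S"
  shows "u \<in> mutation_sequences X7_vertices \<and> v \<in> mutation_sequences X7_vertices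
    \<and> same_chart (run u S) (run v S)"
  using assms(1)
proof cases
  case (1 a b l r)
  let ?T = "run b S"
  have T: "valid_chart ?T" by (rule valid_run[OF 1(4) assms(2)])
  have rel: "mut_relation X7_vertices (chart_matrix ?T) l r"
    using 1(5) chart_matrix_run[OF 1(4) assms(2)] by simp
  have "same_chart (run a (run l ?T)) (run a (run r ?T))"
    using run_relation[OF rel T] mut_relation_in[OF rel] valid_run[OF _ T] 1(3)
    by (intro same_chart_run) auto
  then show ?thesis using 1 mut_relation_in[OF rel] by simp
qed

lemma run_equivclp:
  assumes "equivclp (mut_step X7_vertices (chart_matrix S)) u v"
    and "u \<in> mutation_sequences X7_vertices" "valid_chart S"
  shows "v \<in> mutation_sequences X7_vertices \<and> same_chart (run u S) (run v S)"
  using assms(1)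
proof (induction rule: equivclp_induct)
  case base
  show ?case using assms(2) same_chart_refl[OF valid_run[OF assms(2,3)]] by simp
next
  case (step v w)
  then have w: "w \<in> mutation_sequences X7_vertices" using run_step assms(3) by blast
  then have "same_chart (run v S) (run w S)"
    using step run_step[OF _ assms(3)] same_chart_sym valid_run[OF _ assms(3)] by blast
  with w show ?case
    using step same_chart_trans valid_run[OF assms(2,3)] by blast
qed

section \<open>Words in the generators as mutation sequences\<close>

fun letter_seq :: "X7_gen \<times> bool \<Rightarrow> nat move list" where
  "letter_seq (a, b) = (if b then X7_gen_seq a else inverse_seq (X7_gen_seq a))"

definition word_seq :: "X7_gen signed_word \<Rightarrow> nat move list" where
  "word_seq u = concat (map letter_seq u)"

lemma word_seq_simps [simp]:
  "word_seq [] = []" "word_seq (a # u) = letter_seq a @ word_seq u"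
  "word_seq (u @ v) = word_seq u @ word_seq v"
  by (simp_all add: word_seq_def)

abbreviation start :: chart where "start \<equiv> (True, id, [])"

lemma chart_matrix_start: "chart_matrix (True, id, g) = X7_matrix"
  by (simp add: model_def)

lemma X7_gens_cases:
  assumes "a \<in> X7_gens"
  obtains k where "a = Psi k" "k \<in> {1, 3, 5}" | k where "a = Phi k" "k \<in> {1, 3, 5}"
    | \<sigma> where "a = Sigma_perm \<sigma>" "\<sigma> \<in> S3"
  using assms unfolding X7_gens_def by blast

lemma gen_seq_in: "a \<in> X7_gens \<Longrightarrow> X7_gen_seq a \<in> mutation_sequences X7_vertices"
proof (elim X7_gens_cases)
  fix k :: nat assume "a = Psi k" "k \<in> {1, 3, 5}"
  then show ?thesis
    using psi_seq_eq[of k] psi_perm_permutes[of k] by (auto simp: X7_vertices_def)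
next
  fix k :: nat assume "a = Phi k" "k \<in> {1, 3, 5}"
  moreover from this have "k \<in> X7_vertices" "k + 1 \<in> X7_vertices" by (auto simp: X7_vertices_def)
  ultimately show ?thesis by (simp add: phi_seq_def permutes_swap_id)
qed (simp add: S3_extend_permutes)

lemma letter_seq_in: "fst a \<in> X7_gens \<Longrightarrow> letter_seq a \<in> mutation_sequences X7_vertices"
  by (cases a) (simp add: gen_seq_in inverse_seq_in)

lemma word_seq_in: "u \<in> signed_words X7_gens \<Longrightarrow> word_seq u \<in> mutation_sequences X7_vertices"
  by (induction u) (auto simp: letter_seq_in simp del: letter_seq.simps)

lemma conj_move_id [simp]: "conj_move id = id"
proof
  fix m show "conj_move id m = id m" by (cases m) simp_all
qed

lemma run_translate_start:
  assumes "w \<in> mutation_sequences X7_vertices"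
  shows "run w (x, id, g) = translate id g (run w (x, id, []))"
  using run_translate[OF permutes_id assms, of x g] by simp

lemma run_gen:
  assumes "a \<in> X7_gens"
  shows "same_chart (run (X7_gen_seq a) start) (True, id, [(a, True)])"
proof -
  have valid: "valid_chart (run (X7_gen_seq a) start)" "valid_chart (True, id, [(a, True)])"
    using assms by (auto intro: valid_run_start gen_seq_in permutes_id)
  note I = same_chartI[OF _ valid]
  show ?thesis using assms
  proof (cases rule: X7_gens_cases)
    case (1 k)
    then consider "k = 1" | "k = 3" | "k = 5" by blast
    then show ?thesis
      by cases (intro I[OF id_in_S3]; simp add: 1 psi_seq_eq chart_eval_simps sig_cl_id)+
  next
    case (2 k)
    then consider "k = 1" | "k = 3" | "k = 5" by blast
    then show ?thesis
      by cases (intro I[OF id_in_S3]; simp add: 2 phi_seq_def chart_eval_simps sig_cl_id)+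
  next
    case (3 \<sigma>)
    have "S3_extend \<sigma> (Hilbert_Choice.inv (S3_extend \<sigma>) i) = i" for i
      using S3_extend_permutes[OF 3(2)] by (simp add: permutes_inverses)
    then show ?thesis
      using 3 by (intro I[OF 3(2)]) (simp_all add: word_class_Cons del: mem_Collect_eq)
  qed
qed

lemma run_inverse:
  assumes "w \<in> mutation_sequences X7_vertices" "valid_chart S"
  shows "same_chart (run (inverse_seq w) (run w S)) S"
  using run_equivclp[OF inverse_seq_cancel[OF assms(1)], of S] assms
  by (simp add: inverse_seq_in)

text \<open>For the inverse of a generator, the word of length two that cancels is inserted first, and
the sequence of the generator is then undone by its inverse sequence.\<close>

lemma run_letter:
  assumes "fst a \<in> X7_gens"
  shows "same_chart (run (letter_seq a) start) (True, id, [a])"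
proof -
  obtain c b where a: "a = (c, b)" by fastforce
  then have c: "c \<in> X7_gens" using assms by simp
  show ?thesis
  proof (cases b)
    case True
    then show ?thesis using run_gen[OF c] by (simp add: a)
  next
    case False
    let ?w = "X7_gen_seq c" and ?T = "(True, id, [(c, False)])"
    have w: "?w \<in> mutation_sequences X7_vertices" by (rule gen_seq_in[OF c])
    have T: "valid_chart ?T" using c by (simp add: permutes_id)
    have TT: "valid_chart (True, id, [(c, True), (c, False)])" using c by (simp add: permutes_id)
    have "word_class [(c, True), (c, False)] = pone" using c by (simp add: word_class_Cons)
    then have 1: "same_chart start (True, id, [(c, True), (c, False)])"
      by (intro same_chartI[OF id_in_S3 valid_start TT]) (simp_all add: sig_cl_id)
    have 2: "same_chart (run ?w ?T) (True, id, [(c, True), (c, False)])"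
      using same_chart_translate[OF run_gen[OF c] valid_run_start[OF w], of "[(c, False)]" id] c
      by (simp add: run_translate_start[OF w, of True "[(c, False)]"] permutes_id)
    have "same_chart start (run ?w ?T)"
      using same_chart_trans[OF 1 same_chart_sym[OF 2]] valid_run[OF w T] valid_start by blast
    then have "same_chart (run (inverse_seq ?w) start) (run (inverse_seq ?w) (run ?w ?T))"
      by (intro same_chart_run inverse_seq_in w valid_start valid_run T)
    moreover have "same_chart (run (inverse_seq ?w) (run ?w ?T)) ?T"
      by (rule run_inverse[OF w T])
    ultimately have "same_chart (run (inverse_seq ?w) start) ?T"
      using same_chart_trans valid_run[OF inverse_seq_in[OF w] valid_start] by blast
    then show ?thesis using False by (simp add: a)
  qed
qed

text \<open>The letters are treated one at a time: the word already spelled only enters by a translation of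
charts, and up to \<open>\<S>\<^sub>3\<close> the labels are back at the identity after each letter.\<close>

lemma run_word_seq:
  assumes "u \<in> signed_words X7_gens"
  shows "same_chart (run (word_seq u) start) (True, id, u)"
  using assms
proof (induction u)
  case Nil
  show ?case unfolding word_seq_simps run_simps by (rule same_chart_refl[OF valid_start])
next
  case (Cons a u)
  then have a: "fst a \<in> X7_gens" and u: "u \<in> signed_words X7_gens" by (cases a; simp)+
  have valid: "valid_chart (run (word_seq u) start)" "valid_chart (True, id, u)"
    "valid_chart (True, id, [a])"
    using u a by (auto intro: valid_run_start word_seq_in permutes_id simp del: id_apply) (cases a; simp)
  have "same_chart (run (letter_seq a) (run (word_seq u) start)) (run (letter_seq a) (True, id, u))"
    by (intro same_chart_run letter_seq_in a Cons.IH u valid)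
  moreover have "same_chart (run (letter_seq a) (True, id, u)) (True, id, a # u)"
    using same_chart_translate[OF run_letter[OF a] valid_run_start[OF letter_seq_in[OF a]] valid(3) u, of id]
    by (simp add: run_translate_start[OF letter_seq_in[OF a], of True u] del: letter_seq.simps)
  ultimately show ?case
    unfolding word_seq_simps run_simps
    using same_chart_trans valid_run[OF letter_seq_in[OF a] valid(1)] by blast
qed

lemma word_seq_loop:
  assumes "u \<in> signed_words X7_gens"
  shows "word_seq u \<in> mutation_loops X7_vertices X7_matrix"
  using chart_matrix_run[OF word_seq_in[OF assms] valid_start, of True]
    same_chart_matrix[OF run_word_seq[OF assms]] word_seq_in[OF assms]
  by (simp add: mutation_loops_def model_def)

text \<open>Two equivalent sequences end in charts that differ by some \<open>\<sigma>\<close> in \<open>\<S>\<^sub>3\<close>. As both charts can be taken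
with the identity labelling, this \<open>\<sigma>\<close> is trivial and the words agree.\<close>

lemma word_seq_inject:
  assumes "u \<in> signed_words X7_gens" "v \<in> signed_words X7_gens"
    and "equivclp (mut_step X7_vertices X7_matrix) (word_seq u) (word_seq v)"
  shows "word_class u = word_class v"
proof -
  have valid: "valid_chart (run (word_seq w) start)" if "w \<in> signed_words X7_gens" for w
    using that by (intro valid_run_start word_seq_in)
  have v: "valid_chart (True, id, w)" if "w \<in> signed_words X7_gens" for w
    using that by (simp add: permutes_id)
  have uv: "same_chart (run (word_seq u) start) (run (word_seq v) start)"
    using run_equivclp[of start "word_seq u" "word_seq v"] assms valid_start word_seq_in chart_matrix_start
    by metis
  have u: "same_chart (True, id, u) (run (word_seq u) start)"
    by (rule same_chart_sym[OF run_word_seq[OF assms(1)] valid[OF assms(1)]])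
  have "same_chart (True, id, u) (True, id, v)"
    by (rule same_chart_trans[OF same_chart_trans[OF u uv] run_word_seq[OF assms(2)]])
      (rule v[OF assms(1)])+
  then obtain \<sigma> where \<sigma>: "\<sigma> \<in> S3" "S3_extend \<sigma> = id" "word_class v = sig_cl \<sigma> \<cdot> word_class u"
    by auto
  then have "\<sigma> = id" using S3_extend_inject[of \<sigma> id] by simp
  then show ?thesis using \<sigma> assms by (simp add: sig_cl_id)
qed



section \<open>Every mutation loop is a word in the generators\<close>

abbreviation loop_equiv (infix "\<approx>" 50) where
  "u \<approx> v \<equiv> equivclp (mut_step X7_vertices X7_matrix) u v"

text \<open>A path from \<open>X\<close> to each of the two models; it turns a mutation between models into a loop at \<open>X\<close>.\<close>

definition edge :: "bool \<Rightarrow> nat move list" where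
  "edge x = (if x then [] else [Mut 0])"

lemma edge_in: "edge x \<in> mutation_sequences X7_vertices"
  by (simp add: edge_def X7_vertices_def)

lemma bij_psi_perm [simp]: "bij (psi_perm k)"
  using psi_perm_permutes by (rule permutes_bij)

lemma inv_inv_psi_perm [simp]: "Hilbert_Choice.inv (Hilbert_Choice.inv (psi_perm k)) = psi_perm k"
  using permutes_inv_inv[OF psi_perm_permutes] .

text \<open>A mutation of a model, started from \<open>X\<close> along the chosen path, is the loop named by its letter
followed by the path to the new model and a relabelling. Both sides have the same normal form,
so neither squares nor pentagons enter here.\<close>

lemma edge_step:
  assumes "j \<in> X7_vertices"
  shows "Mut j # edge x \<approx>
    Perm (Hilbert_Choice.inv (relabel x j)) # edge (target x j) @ word_seq (coeff x j)"
    (is "?l \<approx> ?r")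
proof (rule normal_form_eqI)
  show l: "?l \<in> mutation_sequences X7_vertices" using assms by (simp add: edge_in)
  show r: "?r \<in> mutation_sequences X7_vertices"
    by (simp add: edge_in word_seq_in coeff_in permutes_inv relabel_permutes)
  have j: "j = 0 \<or> j = 1 \<or> j = 2 \<or> j = 3 \<or> j = 4 \<or> j = 5 \<or> j = 6"
    using assms by (simp add: X7_vertices_def)
  then have "\<forall>i\<in>X7_vertices. total_perm ?l i = total_perm ?r i"
    unfolding all_vertices
    by (elim disjE; cases x; simp add: edge_def target_def relabel_def coeff_def wing_def
        psi_seq_eq phi_seq_def)
  then show "\<And>i. i \<in> X7_vertices \<Longrightarrow> total_perm ?l i = total_perm ?r i" by blast
  from j show "labels ?l = labels ?r"
    by (elim disjE; cases x; simp add: edge_def target_def relabel_def coeff_def wing_def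
        psi_seq_eq phi_seq_def)
qed

lemma word_seq_apply [simp]: "u \<in> signed_words X7_gens \<Longrightarrow> apply_seq (word_seq u) X7_matrix = X7_matrix"
  using word_seq_loop by (simp add: mutation_loops_def)

text \<open>The chart reached from the standard chart determines the sequence up to equivalence: first
perform the word \<open>g\<close> as a loop at \<open>X\<close>, then go to the model, then relabel.\<close>

lemma pull_back_chart:
  assumes "w \<in> mutation_sequences X7_vertices" "run w start = (x, \<theta>, g)"
  shows "w \<approx> Perm (Hilbert_Choice.inv \<theta>) # edge x @ word_seq g"
  using assms
proof (induction w arbitrary: x \<theta> g)
  case Nil
  then have "x" "\<theta> = id" "g = []" by (auto simp: id_def)
  then show ?case
    using equivclp_sym[OF Perm_id_cancel[of "[]" X7_vertices "[]" X7_matrix]]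
    by (simp add: edge_def id_def)
next
  case (Cons m w)
  from Cons.prems have w: "w \<in> mutation_sequences X7_vertices" by (cases m) auto
  obtain y \<eta> c where R: "run w start = (y, \<eta>, c)" by (metis prod_cases3)
  have step: "move_chart m (y, \<eta>, c) = (x, \<theta>, g)"
    using Cons.prems(2) unfolding run_simps R .
  let ?i = "Hilbert_Choice.inv \<eta>" and ?q = "edge y @ word_seq c"
  have \<eta>: "\<eta> permutes X7_vertices" and c: "c \<in> signed_words X7_gens"
    using valid_run_start[OF w, of True] R by simp_all
  have i: "?i permutes X7_vertices" and q: "?q \<in> mutation_sequences X7_vertices"
    using \<eta> c by (simp_all add: permutes_inv edge_in word_seq_in)
  have "[m] \<in> mutation_sequences X7_vertices" using Cons.prems(1) by (cases m) simp_all
  then have first: "m # w \<approx> m # Perm ?i # ?q"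
    by (intro mut_equivclp_Cons Cons.IH[OF w R])
  show ?case
  proof (cases m)
    case (Mut k)
    let ?j = "\<eta> k"
    have j: "?j \<in> X7_vertices" using Cons.prems(1) Mut \<eta> by (simp add: permutes_in_image)
    let ?h = "Hilbert_Choice.inv (relabel y ?j)"
    have h: "?h permutes X7_vertices" using relabel_permutes by (rule permutes_inv)
    note first
    also have "m # Perm ?i # ?q \<approx> Perm ?i # Mut ?j # ?q"
      using Mut_Perm[of "[]" X7_vertices ?q ?i ?j X7_matrix] \<eta> i q j
      by (simp add: Mut permutes_inverses equivclp_sym)
    also have "Perm ?i # Mut ?j # ?q \<approx>
        Perm ?i # Perm ?h # edge (target y ?j) @ word_seq (coeff y ?j @ c)"
    proof -
      have "[Perm ?i] @ (Mut ?j # edge y) @ word_seq c \<approx>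
          [Perm ?i] @ (Perm ?h # edge (target y ?j) @ word_seq (coeff y ?j)) @ word_seq c"
        by (rule mut_equivclp_context) (use edge_step[OF j, of y] i c in \<open>simp_all add: word_seq_in\<close>)
      then show ?thesis by simp
    qed
    also have "\<dots> \<approx> Perm (?i \<circ> ?h) # edge (target y ?j) @ word_seq (coeff y ?j @ c)"
      using Perm_Perm[of "[]" X7_vertices "edge (target y ?j) @ word_seq (coeff y ?j @ c)" ?i ?h X7_matrix]
        i h c by (simp add: edge_in word_seq_in coeff_in)
    also have "?i \<circ> ?h = Hilbert_Choice.inv (relabel y ?j \<circ> \<eta>)"
      by (rule o_inv_distrib[OF permutes_bij[OF relabel_permutes] permutes_bij[OF \<eta>], symmetric])
    finally show ?thesis using step Mut by (auto simp: comp_def)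
  next
    case (Perm \<sigma>)
    then have \<sigma>: "\<sigma> permutes X7_vertices" using Cons.prems(1) by simp
    note first
    also have "m # Perm ?i # ?q \<approx> Perm (\<sigma> \<circ> ?i) # ?q"
      using Perm_Perm[of "[]" X7_vertices ?q \<sigma> ?i X7_matrix] \<sigma> i q by (simp add: Perm)
    also have "\<sigma> \<circ> ?i = Hilbert_Choice.inv (\<eta> \<circ> Hilbert_Choice.inv \<sigma>)"
      by (simp add: permutes_inv_inv[OF \<sigma>]
          o_inv_distrib[OF permutes_bij[OF \<eta>] permutes_bij[OF permutes_inv[OF \<sigma>]]])
    finally show ?thesis using step Perm by (auto simp: comp_def)
  qed
qed

lemma loop_is_word:
  assumes "w \<in> mutation_loops X7_vertices X7_matrix"
  shows "\<exists>u\<in>signed_words X7_gens. word_seq u \<approx> w"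
proof -
  have w: "w \<in> mutation_sequences X7_vertices" "apply_seq w X7_matrix = X7_matrix"
    using assms by (simp_all add: mutation_loops_def)
  obtain x \<theta> g where R: "run w start = (x, \<theta>, g)" by (metis prod_cases3)
  have \<theta>: "\<theta> permutes X7_vertices" and g: "g \<in> signed_words X7_gens"
    using valid_run_start[OF w(1), of True] R by simp_all
  have "chart_matrix (x, \<theta>, g) = X7_matrix"
    using chart_matrix_run[OF w(1) valid_start, of True] w(2) R by (simp only: chart_matrix_start)
  then have eq: "model x (\<theta> i) (\<theta> j) = X7_matrix i j" for i j by (simp add: fun_eq_iff)
  then have x using not_X7_model[OF \<theta>] by (cases x) auto
  then have "X7_matrix (\<theta> i) (\<theta> j) = X7_matrix i j" for i j using eq[of i j] by (simp add: model_def)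
  then obtain \<sigma> where \<sigma>: "\<sigma> \<in> S3" "\<theta> = S3_extend \<sigma>" using stabilizer_X7[OF \<theta>] by blast
  let ?u = "(Sigma_perm (Hilbert_Choice.inv \<sigma>), True) # g"
  have "?u \<in> signed_words X7_gens"
    using g inv_in_S3[OF \<sigma>(1)] by (simp del: mem_Collect_eq)
  moreover have "word_seq ?u = Perm (Hilbert_Choice.inv \<theta>) # edge x @ word_seq g"
    using \<open>x\<close> by (simp add: \<sigma>(2) inv_S3_extend[OF \<sigma>(1)] edge_def)
  ultimately show ?thesis using equivclp_sym[OF pull_back_chart[OF w(1) R]] by metis
qed

section \<open>The relations hold\<close>

lemma conjugate_seq:
  assumes "\<sigma> permutes I" "w \<in> mutation_sequences I"
  shows "equivclp (mut_step I \<epsilon>) (Perm \<sigma> # w @ [Perm (Hilbert_Choice.inv \<sigma>)]) (map (conj_move \<sigma>) w)"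
  using assms(2)
proof (induction w)
  case Nil
  have "equivclp (mut_step I \<epsilon>) [Perm \<sigma>, Perm (Hilbert_Choice.inv \<sigma>)] [Perm (\<sigma> \<circ> Hilbert_Choice.inv \<sigma>)]"
    using Perm_Perm[of "[]" I "[]" \<sigma> "Hilbert_Choice.inv \<sigma>" \<epsilon>] assms(1) by (simp add: permutes_inv)
  also have "equivclp (mut_step I \<epsilon>) [Perm (\<sigma> \<circ> Hilbert_Choice.inv \<sigma>)] []"
    using Perm_id_cancel[of "[]" I "[]" \<epsilon>] assms(1) by (simp add: permutes_inv_o)
  finally show ?case by simp
next
  case (Cons m w)
  from Cons.prems have w: "w \<in> mutation_sequences I" by (cases m) auto
  let ?q = "w @ [Perm (Hilbert_Choice.inv \<sigma>)]"
  have q: "?q \<in> mutation_sequences I" using w assms(1) by (simp add: permutes_inv)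
  have "equivclp (mut_step I \<epsilon>) (Perm \<sigma> # m # ?q) (conj_move \<sigma> m # Perm \<sigma> # ?q)"
  proof (cases m)
    case (Mut k)
    then show ?thesis
      using Mut_Perm[of "[]" I ?q \<sigma> k \<epsilon>] Cons.prems assms(1) q by simp
  next
    case (Perm \<tau>)
    let ?c = "\<sigma> \<circ> \<tau> \<circ> Hilbert_Choice.inv \<sigma>"
    have \<tau>: "\<tau> permutes I" using Perm Cons.prems by simp
    have c: "?c permutes I" using \<tau> assms(1) by (intro permutes_compose permutes_inv)
    have "?c \<circ> \<sigma> = \<sigma> \<circ> \<tau>" using assms(1) by (simp add: comp_assoc permutes_inv_o)
    then show ?thesis
      using Perm_Perm[of "[]" I ?q \<sigma> \<tau> \<epsilon>] equivclp_sym[OF Perm_Perm[of "[]" I ?q ?c \<sigma> \<epsilon>]] \<tau> c assms(1) q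
      by (simp add: Perm) (blast intro: equivclp_trans)
  qed
  also have "equivclp (mut_step I \<epsilon>) (conj_move \<sigma> m # Perm \<sigma> # ?q) (conj_move \<sigma> m # map (conj_move \<sigma>) w)"
  proof (rule mut_equivclp_Cons)
    show "equivclp (mut_step I \<epsilon>) (Perm \<sigma> # ?q) (map (conj_move \<sigma>) w)" by (rule Cons.IH[OF w])
    show "[conj_move \<sigma> m] \<in> mutation_sequences I"
      using conj_move_in[OF assms(1), of "[m]"] Cons.prems by (cases m) simp_all
  qed
  finally show ?case by simp
qed


lemma conj_move_psi_phi:
  assumes "\<sigma> \<in> S3" "k \<in> {1, 3, 5}"
  shows "map (conj_move (S3_extend \<sigma>)) (psi_seq k) = psi_seq (\<sigma> k)"
    and "map (conj_move (S3_extend \<sigma>)) (phi_seq k) = phi_seq (\<sigma> k)"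
proof -
  let ?s = "S3_extend \<sigma>"
  have \<sigma>k: "\<sigma> k \<in> {1, 3, 5}" using assms by (simp only: mem_Collect_eq permutes_in_image)
  have inverse: "?s \<circ> Hilbert_Choice.inv ?s = id"
    using permutes_inv_o(1)[OF S3_extend_permutes[OF assms(1)]] .
  have s: "?s k = \<sigma> k" "?s (k + 1) = \<sigma> k + 1" "?s 0 = 0" using assms(2) by auto
  have "relabel x (\<sigma> k) = ?s \<circ> relabel x k \<circ> Hilbert_Choice.inv ?s" for x
  proof -
    have "k \<in> X7_vertices" using assms(2) by (auto simp: X7_vertices_def)
    then have "relabel x (\<sigma> k) \<circ> (?s \<circ> Hilbert_Choice.inv ?s) = ?s \<circ> relabel x k \<circ> Hilbert_Choice.inv ?s"
      using relabel_S3[OF assms(1), of k x] s(1) by (simp add: o_assoc)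
    then show ?thesis by (simp add: inverse)
  qed
  from this[of True] this[of False]
  have "transpose (\<sigma> k) (\<sigma> k + 1) = ?s \<circ> transpose k (k + 1) \<circ> Hilbert_Choice.inv ?s"
    "psi_perm (\<sigma> k) = ?s \<circ> psi_perm k \<circ> Hilbert_Choice.inv ?s"
    using assms(2) \<sigma>k by (auto simp: relabel_def wing_def)
  then show "map (conj_move ?s) (psi_seq k) = psi_seq (\<sigma> k)"
    "map (conj_move ?s) (phi_seq k) = phi_seq (\<sigma> k)"
    using s by (simp_all add: psi_seq_eq[OF assms(2)] psi_seq_eq[OF \<sigma>k] phi_seq_def)
qed

lemma mutate_0_entries:
  "X7_matrix 1 3 = 0" "X7_matrix 0 1 = 1" "mutate 0 X7_matrix 3 1 = 0" "mutate 0 X7_matrix 1 4 = -1"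
  by (simp_all add: mutate_def X7_matrix_def X7_arrows_def)

lemma square_step:
  assumes "i \<in> X7_vertices" "j \<in> X7_vertices" "apply_seq q X7_matrix i j = 0"
    and "p \<in> mutation_sequences X7_vertices" "q \<in> mutation_sequences X7_vertices"
  shows "p @ [Mut i, Mut j] @ q \<approx> p @ [Mut j, Mut i] @ q"
  using assms by (intro mut_equivclp_relation mut_relation.square)

lemma pentagon_step:
  assumes "i \<in> X7_vertices" "j \<in> X7_vertices"
    and "apply_seq q X7_matrix i j = 1 \<or> apply_seq q X7_matrix i j = -1"
    and "p \<in> mutation_sequences X7_vertices" "q \<in> mutation_sequences X7_vertices"
  shows "p @ [Mut i, Mut j, Mut i, Mut j, Mut i] @ q \<approx> p @ [Perm (transpose i j)] @ q"
  using assms by (intro mut_equivclp_relation mut_relation.pentagon)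

lemma vertices_in: "0 \<in> X7_vertices" "1 \<in> X7_vertices" "2 \<in> X7_vertices" "3 \<in> X7_vertices"
  "4 \<in> X7_vertices" "5 \<in> X7_vertices" "6 \<in> X7_vertices"
  by (simp_all add: X7_vertices_def)

lemmas seq_simps = vertices_in permutes_swap_id permutes_compose permutes_inv psi_perm_permutes
  S3_extend_permutes permutes_id psi_seq_eq phi_seq_def all_vertices

lemma normal_form_vertices_eqI:
  assumes "u \<in> mutation_sequences X7_vertices" "v \<in> mutation_sequences X7_vertices"
    and "\<forall>i\<in>X7_vertices. total_perm u i = total_perm v i" and "labels u = labels v"
  shows "u \<approx> v"
  using assms by (intro normal_form_eqI) auto

text \<open>Each relation that does not involve an arbitrary element of \<open>\<S>\<^sub>3\<close> becomes a single square or
pentagon once both sides are compared by normal forms. If \<open>\<mu>\<^sub>0\<close> stands to its right, that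
square or pentagon is one of \<open>Y\<close>.\<close>

lemma phi_commute_seq: "phi_seq 1 @ phi_seq 3 \<approx> phi_seq 3 @ phi_seq 1"
proof -
  let ?p = "[Perm (transpose 1 2 \<circ> transpose 3 4)] :: nat move list"
  have "phi_seq 1 @ phi_seq 3 \<approx> ?p @ [Mut 1, Mut 3] @ []"
    by (rule normal_form_vertices_eqI) (simp_all add: seq_simps)
  also have "?p @ [Mut 1, Mut 3] @ [] \<approx> ?p @ [Mut 3, Mut 1] @ []"
    by (rule square_step) (simp_all add: seq_simps mutate_0_entries)
  also have "?p @ [Mut 3, Mut 1] @ [] \<approx> phi_seq 3 @ phi_seq 1"
    by (rule normal_form_vertices_eqI) (simp_all add: seq_simps)
  finally show ?thesis .
qed

lemma phi_psi_seq: "phi_seq 1 \<approx> psi_seq 1 @ psi_seq 1 @ [Perm (S3_extend (transpose 3 5))]"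
proof -
  \<comment> \<open>The normal form of the right-hand side is \<open>\<mu>\<^sub>1\<mu>\<^sub>0\<mu>\<^sub>1\<mu>\<^sub>0\<close> after a permutation; writing \<open>\<mu>\<^sub>0\<mu>\<^sub>0\<close> in front
       completes it to a pentagon.\<close>
  let ?p = "[Perm (transpose 1 2 \<circ> transpose 0 1), Mut 0] :: nat move list"
  have inv: "Hilbert_Choice.inv (S3_extend (transpose 3 5)) = S3_extend (transpose 3 5)"
    using inv_S3_extend[OF transposition_in_S3(1)] by simp
  have "phi_seq 1 \<approx> ?p @ [Perm (transpose 0 1)] @ []"
    by (rule normal_form_vertices_eqI) (simp_all add: seq_simps)
  also have "?p @ [Perm (transpose 0 1)] @ [] \<approx> ?p @ [Mut 0, Mut 1, Mut 0, Mut 1, Mut 0] @ []"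
    by (rule equivclp_sym, rule pentagon_step) (simp_all add: seq_simps mutate_0_entries)
  also have "?p @ [Mut 0, Mut 1, Mut 0, Mut 1, Mut 0] @ [] \<approx>
      psi_seq 1 @ psi_seq 1 @ [Perm (S3_extend (transpose 3 5))]"
    using S3_extend_permutes[OF transposition_in_S3(1)] S3_extend_permutes[OF transposition_in_S3(1), THEN permutes_bij]
    by (intro normal_form_vertices_eqI) (simp_all add: seq_simps inv o_inv_distrib)
  finally show ?thesis .
qed

lemma psi_square_seq:
  "[] \<approx> inverse_seq (psi_seq 3) @ psi_seq 1 @ inverse_seq (psi_seq 3) @ psi_seq 1" (is "_ \<approx> ?w")
proof -
  have "[] \<approx> [Mut 0, Mut 3, Mut 1] @ [Mut 1, Mut 3] @ [Mut 0]"
    by (rule normal_form_vertices_eqI) (simp_all add: seq_simps)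
  also have "[Mut 0, Mut 3, Mut 1] @ [Mut 1, Mut 3] @ [Mut 0] \<approx> [Mut 0, Mut 3, Mut 1] @ [Mut 3, Mut 1] @ [Mut 0]"
    by (rule equivclp_sym, rule square_step) (simp_all add: seq_simps mutate_0_entries)
  also have "[Mut 0, Mut 3, Mut 1] @ [Mut 3, Mut 1] @ [Mut 0] \<approx> ?w"
    by (rule normal_form_vertices_eqI) (simp_all add: seq_simps o_inv_distrib bij_imp_bij_inv bij_comp)
  finally show ?thesis .
qed

lemma S3_cycle: "S3_extend (cycle_of_list [1, 5, 3]) permutes X7_vertices"
  using cycle_in_S3 by (rule S3_extend_permutes)

lemma psi_five_seq:
  "[] \<approx> Perm (S3_extend (cycle_of_list [1, 5, 3])) #
    psi_seq 5 @ psi_seq 1 @ psi_seq 3 @ psi_seq 5 @ psi_seq 1" (is "_ \<approx> ?w")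
proof -
  \<comment> \<open>The fifteen mutations of the right-hand side reduce to a pentagon at \<open>Y\<close> on the vertices 1
       and 4, between two mutations at 0.\<close>
  let ?p = "[Perm (transpose 1 4), Mut 0] :: nat move list"
  have "[] \<approx> ?p @ [Perm (transpose 1 4)] @ [Mut 0]"
    by (rule normal_form_vertices_eqI) (simp_all add: seq_simps)
  also have "?p @ [Perm (transpose 1 4)] @ [Mut 0] \<approx> ?p @ [Mut 1, Mut 4, Mut 1, Mut 4, Mut 1] @ [Mut 0]"
    by (rule equivclp_sym, rule pentagon_step) (simp_all add: seq_simps mutate_0_entries)
  also have "?p @ [Mut 1, Mut 4, Mut 1, Mut 4, Mut 1] @ [Mut 0] \<approx> ?w"
  proof (rule normal_form_vertices_eqI)
    show "?w \<in> mutation_sequences X7_vertices"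
      using S3_cycle by (simp add: seq_simps del: cycle_of_list.simps)
  qed (simp_all add: seq_simps o_inv_distrib bij_imp_bij_inv bij_comp)
  finally show ?thesis .
qed


lemma relation_seq:
  assumes "X7_relation l r"
  shows "word_seq l \<approx> word_seq r"
  using assms
proof cases
  case (S3_table \<sigma> \<tau>)
  then have "\<sigma> \<in> S3" "\<tau> \<in> S3" by simp_all
  then show ?thesis
    using Perm_Perm[of "[]" X7_vertices "[]" "S3_extend \<sigma>" "S3_extend \<tau>" X7_matrix]
    by (simp add: S3_table S3_extend_permutes S3_extend_comp del: mem_Collect_eq)
next
  case (sig_psi \<sigma> k)
  then have \<sigma>: "\<sigma> \<in> S3" by simp
  have "psi_seq k \<in> mutation_sequences X7_vertices" using gen_seq_in[of "Psi k"] sig_psi(4) by simp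
  from conjugate_seq[OF S3_extend_permutes[OF \<sigma>] this, of X7_matrix]
  show ?thesis using conj_move_psi_phi[OF \<sigma> sig_psi(4)] by (simp add: sig_psi(1,2))
next
  case (sig_phi \<sigma> k)
  then have \<sigma>: "\<sigma> \<in> S3" by simp
  have "phi_seq k \<in> mutation_sequences X7_vertices" using gen_seq_in[of "Phi k"] sig_phi(4) by simp
  from conjugate_seq[OF S3_extend_permutes[OF \<sigma>] this, of X7_matrix]
  show ?thesis using conj_move_psi_phi[OF \<sigma> sig_phi(4)] by (simp add: sig_phi(1,2))
next
  case phi_commute
  then show ?thesis using phi_commute_seq by simp
next
  case phi_psi
  then show ?thesis using phi_psi_seq by simp
next
  case psi_square
  then show ?thesis using psi_square_seq by simp
next
  case psi_five
  then show ?thesis using psi_five_seq by (simp del: cycle_of_list.simps)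
qed

lemma inverse_seq_inverse_seq:
  "w \<in> mutation_sequences I \<Longrightarrow> inverse_seq (inverse_seq w) = w"
proof (induction w)
  case (Cons m w)
  then show ?case using permutes_inv_inv[of _ I] by (cases m) auto
qed simp

lemma letter_seq_cancel:
  assumes "a \<in> X7_gens"
  shows "equivclp (mut_step X7_vertices \<epsilon>) (letter_seq (a, b) @ letter_seq (a, \<not> b)) []"
proof -
  note w = gen_seq_in[OF assms]
  show ?thesis
    using inverse_seq_cancel[OF w, of \<epsilon>] inverse_seq_cancel[OF inverse_seq_in[OF w], of \<epsilon>]
    by (cases b) (simp_all add: inverse_seq_inverse_seq[OF w])
qed

lemma pres_step_word_seq:
  assumes "pres_step X7_gens X7_relation u v"
  shows "word_seq u \<approx> word_seq v"
  using assms
proof cases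
  case (cancel a p q b)
  have "word_seq p @ (letter_seq (a, b) @ letter_seq (a, \<not> b)) @ word_seq q \<approx> word_seq p @ [] @ word_seq q"
    using cancel by (intro mut_equivclp_context letter_seq_cancel word_seq_in)
  then show ?thesis by (simp add: cancel del: letter_seq.simps)
next
  case (relation l r p q)
  have "word_seq p @ word_seq l @ word_seq q \<approx> word_seq p @ word_seq r @ word_seq q"
    using relation relation_seq[OF relation(3)] by (intro mut_equivclp_context word_seq_in) simp_all
  then show ?thesis by (simp add: relation)
qed

lemma word_seq_equiv_iff:
  assumes "u \<in> signed_words X7_gens" "v \<in> signed_words X7_gens"
  shows "(word_seq u, word_seq v) \<in> mut_equiv X7_vertices X7_matrix
    \<longleftrightarrow> (u, v) \<in> pres_equiv X7_gens X7_relation"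
proof
  assume "(word_seq u, word_seq v) \<in> mut_equiv X7_vertices X7_matrix"
  then show "(u, v) \<in> pres_equiv X7_gens X7_relation"
    using word_seq_inject[OF assms] word_class_eq_iff[OF assms] by (simp add: mut_equiv_def)
next
  assume "(u, v) \<in> pres_equiv X7_gens X7_relation"
  then have "equivclp (pres_step X7_gens X7_relation) u v" by (simp add: pres_equiv_def)
  then have "word_seq u \<approx> word_seq v" by (rule equivclp_map) (rule pres_step_word_seq)
  then show "(word_seq u, word_seq v) \<in> mut_equiv X7_vertices X7_matrix"
    using assms by (simp add: mut_equiv_def word_seq_loop)
qed

section \<open>The presentation of the saturated cluster modular group\<close>

interpretation G: word_congruence "mutation_loops X7_vertices X7_matrix" "mut_equiv X7_vertices X7_matrix"
  by (rule word_congruence_loops)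

interpretation G: group X7_group
  unfolding saturated_cluster_modular_group_def by (rule G.group_word_quotient)

lemma gen_elem_word: "X7_gen_elem a = mut_equiv X7_vertices X7_matrix `` {word_seq [(a, True)]}"
  by (simp add: X7_gen_elem_def)

lemma gen_elem_in: "a \<in> X7_gens \<Longrightarrow> X7_gen_elem a \<in> carrier X7_group"
  unfolding gen_elem_word saturated_cluster_modular_group_def
  by (intro G.class_in word_seq_loop) simp

lemma word_in_generate:
  assumes "u \<in> signed_words X7_gens"
  shows "mut_equiv X7_vertices X7_matrix `` {word_seq u} \<in> generate X7_group (X7_gen_elem ` X7_gens)"
  using assms
proof (induction u)
  case Nil
  then show ?case
    using generate.one[of X7_group] by (simp add: saturated_cluster_modular_group_def G.one_class)
next
  case (Cons p u)
  obtain a b where p: "p = (a, b)" by fastforce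
  let ?c = "\<lambda>w. mut_equiv X7_vertices X7_matrix `` {w}"
  have a: "a \<in> X7_gens" and u: "u \<in> signed_words X7_gens" using Cons.prems p by simp_all
  have loops: "word_seq [(a, True)] \<in> mutation_loops X7_vertices X7_matrix"
    "word_seq [(a, False)] \<in> mutation_loops X7_vertices X7_matrix"
    "word_seq [(a, b)] \<in> mutation_loops X7_vertices X7_matrix"
    "word_seq u \<in> mutation_loops X7_vertices X7_matrix"
    using a u by (intro word_seq_loop; simp)+
  have mem: "X7_gen_elem a \<in> X7_gen_elem ` X7_gens" using a by (rule imageI)
  have "?c (word_seq [(a, b)]) \<in> generate X7_group (X7_gen_elem ` X7_gens)"
  proof (cases b)
    case True
    then have "?c (word_seq [(a, b)]) = X7_gen_elem a" by (simp only: gen_elem_word)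
    then show ?thesis using generate.incl[OF mem] by (simp only:)
  next
    case False
    have "word_seq [(a, False)] @ word_seq [(a, True)] \<approx> []"
      using letter_seq_cancel[OF a, of X7_matrix False] by simp
    then have "(word_seq [(a, False)] @ word_seq [(a, True)], []) \<in> mut_equiv X7_vertices X7_matrix"
      using loops G.append_in G.Nil_in by (simp only: mut_equiv_def) blast
    then have "inv\<^bsub>X7_group\<^esub> X7_gen_elem a = ?c (word_seq [(a, False)])"
      unfolding gen_elem_word saturated_cluster_modular_group_def by (intro G.inv_class loops)
    moreover have "b = False" using False by simp
    ultimately show ?thesis using generate.inv[OF mem, of X7_group] by (simp only:)
  qed
  moreover have "?c (word_seq (p # u)) = ?c (word_seq [(a, b)]) \<otimes>\<^bsub>X7_group\<^esub> ?c (word_seq u)"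
    unfolding saturated_cluster_modular_group_def G.mult_class[OF loops(3,4)] by (simp add: p)
  ultimately show ?case using Cons.IH[OF u] by (simp only: generate.eng)
qed

theorem theorem1p1:
  shows "group X7_group
    \<and> X7_gen_elem ` X7_gens \<subseteq> carrier X7_group
    \<and> generate X7_group (X7_gen_elem ` X7_gens) = carrier X7_group
    \<and> is_presentation X7_group X7_gen_elem X7_gens X7_relation"
proof (intro conjI)
  show "group X7_group" by (rule G.group_axioms)
  show gens: "X7_gen_elem ` X7_gens \<subseteq> carrier X7_group" using gen_elem_in by blast
  have surj: "\<exists>u\<in>signed_words X7_gens. (word_seq u, w) \<in> mut_equiv X7_vertices X7_matrix"
    if "w \<in> mutation_loops X7_vertices X7_matrix" for w
    using loop_is_word[OF that] that word_seq_loop by (fastforce simp: mut_equiv_def)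
  show "generate X7_group (X7_gen_elem ` X7_gens) = carrier X7_group"
  proof
    show "generate X7_group (X7_gen_elem ` X7_gens) \<subseteq> carrier X7_group"
      using gens G.generate_in_carrier by blast
    show "carrier X7_group \<subseteq> generate X7_group (X7_gen_elem ` X7_gens)"
    proof
      fix C assume "C \<in> carrier X7_group"
      then obtain w where w: "w \<in> mutation_loops X7_vertices X7_matrix"
        "C = mut_equiv X7_vertices X7_matrix `` {w}"
        unfolding saturated_cluster_modular_group_def by (elim G.class_cases)
      then obtain u where u: "u \<in> signed_words X7_gens" "(word_seq u, w) \<in> mut_equiv X7_vertices X7_matrix"
        using surj by blast
      then have "C = mut_equiv X7_vertices X7_matrix `` {word_seq u}"
        using w G.class_eq_iff[OF word_seq_loop[OF u(1)] w(1)] by simp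
      then show "C \<in> generate X7_group (X7_gen_elem ` X7_gens)" using word_in_generate[OF u(1)] by simp
    qed
  qed
  have "\<exists>h \<in> iso (presented_group X7_gens X7_relation) X7_group.
      \<forall>u\<in>signed_words X7_gens. h (pres_equiv X7_gens X7_relation `` {u}) =
        mut_equiv X7_vertices X7_matrix `` {word_seq u}"
    unfolding presented_group_def saturated_cluster_modular_group_def
    by (rule word_quotient_iso[OF word_congruence_pres word_congruence_loops])
      (simp_all add: word_seq_loop word_seq_equiv_iff surj)
  then obtain h where h: "h \<in> iso (presented_group X7_gens X7_relation) X7_group"
    and h_word: "\<And>u. u \<in> signed_words X7_gens \<Longrightarrow> h (pres_equiv X7_gens X7_relation `` {u}) =
        mut_equiv X7_vertices X7_matrix `` {word_seq u}"
    by blast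
  have "h (pres_equiv X7_gens X7_relation `` {[(a, True)]}) = X7_gen_elem a" if "a \<in> X7_gens" for a
    unfolding gen_elem_word using that by (intro h_word) simp
  with h show "is_presentation X7_group X7_gen_elem X7_gens X7_relation"
    unfolding is_presentation_def by blast
qed

end
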